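(* Let $V=(S,T)$ be a pure $p$-isopair of finite bimultiplicity with minimal polynomial $p\in\mathbb C[z,w]$, and write $p=p_1p_2\cdots p_s$ as a product of distinct irreducible factors. If $V$ has rank $(\alpha_1,\alpha_2,\dots,\alpha_s)$, then $V$ is nearly $\max\{\alpha_1,\dots,\alpha_s\}$-cyclic.
   Context: Let $\mathbb D$, $\mathbb T$, $\mathbb E$ be the open unit disk, the unit circle, and the complement of the closed unit disk in $\mathbb C$. $Z(p)$ is the zero set of a polynomial $p$. A polynomial $p\in\mathbb C[z,w]$ is square free if no $q^2$ with $q$ non-constant divides $p$; it is inner toral if $Z(p)\subset \mathbb D^2\cup\mathbb T^2\cup\mathbb E^2$. An isometry $S$ on a (complex) Hilbert space $H$ is pure if $\bigcap_{j\ge1}S^jH=\{0\}$; its multiplicity is $\operatorname{mult}(S)=\dim\ker(S^* )$. A pure isopair is a pair $V=(S,T)$ of commuting pure isometries on the same Hilbert space. For a nonzero polynomial $q$, $V$ is a pure $q$-isopair if $q(S,T)=0$; $V$ is algebraic if it is a pure $q$-isopair for some nonzero $q$. The bimultiplicity of $V$ is $(\operatorname{mult}(S),\operatorname{mult}(T))$; it is finite if both entries are. Minimal polynomial: for a pure algebraic isopair $V=(S,T)$ it is known that there is a square free inner toral polynomial $p$ with $p(S,T)=0$ such that $p$ divides every $q$ with $q(S,T)=0$; it is unique up to a nonzero constant factor and is called the minimal polynomial of $V$. Rank: let $V=(S,T)$ have finite bimultiplicity and minimal polynomial $p=p_1\cdots p_s$ with distinct irreducible factors $p_j$ (each is inner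 toral). Put $\mathfrak V(p_j)=Z(p_j)\cap\mathbb D^2$. A point $(\lambda,\mu)$ is regular for $p$ if $p(\lambda,\mu)=0$ and $\nabla p(\lambda,\mu)=(\partial p/\partial z,\partial p/\partial w)|_{(\lambda,\mu)}\ne0$. For each $j$, $\dim(\ker(S-\lambda)^*\cap\ker(T-\mu)^* )$ takes the same positive integer value $\alpha_j$ at every $(\lambda,\mu)\in\mathfrak V(p_j)$ that is regular for $p$; the rank of $V$ is $\alpha=(\alpha_1,\dots,\alpha_s)$. Cyclicity: an isopair $V=(S,T)$ on $H$ is at most nearly $k$-cyclic if there are distinct $f_1,\dots,f_k\in H$ such that the closure of $\{\sum_{j=1}^k q_j(S,T)f_j: q_j\in\mathbb C[z,w]\}$ has finite codimension in $H$. It is at least nearly $k$-cyclic if for every $l<k$ and all $f_1,\dots,f_l\in H$ the closure of $\{\sum_{j=1}^l q_j(S,T)f_j: q_j\in\mathbb C[z,w]\}$ does not have finite codimension in $H$. It is nearly $k$-cyclic if it is both at most and at least nearly $k$-cyclic. *)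

theory Defs
  imports "HOL-Analysis.Analysis" "HOL-Computational_Algebra.Computational_Algebra"
begin

section \<open>Complex Hilbert spaces\<close>

text \<open>The inner product is linear in its first argument.  Positive definiteness is part of
  the last axiom, since the norm is positive definite.\<close>

class complex_inner = real_normed_vector +
  fixes scaleC :: "complex \<Rightarrow> 'a \<Rightarrow> 'a"  (infixr \<open>*\<^sub>C\<close> 75)
    and cinner :: "'a \<Rightarrow> 'a \<Rightarrow> complex"
  assumes scaleC_add_right: "a *\<^sub>C (x + y) = a *\<^sub>C x + a *\<^sub>C y"
    and scaleC_add_left: "(a + b) *\<^sub>C x = a *\<^sub>C x + b *\<^sub>C x"
    and scaleC_scaleC: "a *\<^sub>C (b *\<^sub>C x) = (a * b) *\<^sub>C x"
    and scaleR_scaleC: "r *\<^sub>R x = complex_of_real r *\<^sub>C x"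
    and cinner_commute: "cinner x y = cnj (cinner y x)"
    and cinner_add_left: "cinner (x + y) z = cinner x z + cinner y z"
    and cinner_scaleC_left: "cinner (a *\<^sub>C x) y = a * cinner x y"
    and cinner_same: "cinner x x = complex_of_real ((norm x)\<^sup>2)"

class chilbert_space = complex_inner + complete_space

global_interpretation complex_vector:
  vector_space "scaleC :: complex \<Rightarrow> 'a \<Rightarrow> 'a::complex_inner"
proof
  show "1 *\<^sub>C x = x" for x :: 'a
    using scaleR_scaleC[of 1 x] by simp
qed (simp_all add: scaleC_add_right scaleC_add_left scaleC_scaleC)

definition clinear :: "('a::complex_inner \<Rightarrow> 'b::complex_inner) \<Rightarrow> bool" where
  "clinear f \<longleftrightarrow> Vector_Spaces.linear scaleC scaleC f"

definition cadjoint :: "('a::complex_inner \<Rightarrow> 'b::complex_inner) \<Rightarrow> 'b \<Rightarrow> 'a" where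
  "cadjoint f = (SOME g. \<forall>x y. cinner (f x) y = cinner x (g y))"

definition kernel :: "('a::complex_inner \<Rightarrow> 'b::complex_inner) \<Rightarrow> 'a set" where
  "kernel f = {x. f x = 0}"

definition cdim :: "'a::complex_inner set \<Rightarrow> enat" where
  "cdim M = (if \<exists>B. finite B \<and> M \<subseteq> complex_vector.span B
             then enat (complex_vector.dim M) else \<infinity>)"

text \<open>For a subspace \<open>M\<close>, this says that the quotient by \<open>M\<close> is finite dimensional.\<close>

definition finite_codim :: "'a::complex_inner set \<Rightarrow> bool" where
  "finite_codim M \<longleftrightarrow> (\<exists>B. finite B \<and> complex_vector.span (M \<union> B) = UNIV)"


section \<open>Polynomials in two variables\<close>

text \<open>The ring \<open>\<complex>[z,w]\<close> is rendered as \<open>\<complex>[z][w]\<close>, the type \<^typ>\<open>complex poly poly\<close>: the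
  coefficient of \<open>z^j w^i\<close> in \<open>q\<close> is \<open>coeff (coeff q i) j\<close>.\<close>

definition eval2 :: "complex poly poly \<Rightarrow> complex \<Rightarrow> complex \<Rightarrow> complex" where
  "eval2 q z w = poly (poly q [:w:]) z"

definition pderiv_z :: "complex poly poly \<Rightarrow> complex poly poly" where
  "pderiv_z q = map_poly pderiv q"

definition pderiv_w :: "complex poly poly \<Rightarrow> complex poly poly" where
  "pderiv_w q = pderiv q"

definition zero_set :: "complex poly poly \<Rightarrow> (complex \<times> complex) set" where
  "zero_set q = {(z, w). eval2 q z w = 0}"

definition inner_toral :: "complex poly poly \<Rightarrow> bool" where
  "inner_toral q \<longleftrightarrow>
     zero_set q \<subseteq> (ball 0 1 \<times> ball 0 1) \<union> (sphere 0 1 \<times> sphere 0 1) \<union>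
       ((- cball 0 1) \<times> (- cball 0 1))"

definition inner_variety :: "complex poly poly \<Rightarrow> (complex \<times> complex) set" where
  "inner_variety q = zero_set q \<inter> (ball 0 1 \<times> ball 0 1)"

definition regular_point :: "complex poly poly \<Rightarrow> complex \<Rightarrow> complex \<Rightarrow> bool" where
  "regular_point q z w \<longleftrightarrow>
     eval2 q z w = 0 \<and> (eval2 (pderiv_z q) z w, eval2 (pderiv_w q) z w) \<noteq> (0, 0)"

definition poly_op ::
  "complex poly poly \<Rightarrow> ('a::complex_inner \<Rightarrow> 'a) \<Rightarrow> ('a \<Rightarrow> 'a) \<Rightarrow> 'a \<Rightarrow> 'a" where
  "poly_op q S T x =
     (\<Sum>i\<le>degree q. \<Sum>j\<le>degree (coeff q i). coeff (coeff q i) j *\<^sub>C (S ^^ j) ((T ^^ i) x))"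


section \<open>Pure isopairs\<close>

definition isometry :: "('a::complex_inner \<Rightarrow> 'a) \<Rightarrow> bool" where
  "isometry S \<longleftrightarrow> clinear S \<and> (\<forall>x. norm (S x) = norm x)"

definition pure_isometry :: "('a::complex_inner \<Rightarrow> 'a) \<Rightarrow> bool" where
  "pure_isometry S \<longleftrightarrow> isometry S \<and> (\<Inter>j\<in>{1..}. range (S ^^ j)) = {0}"

definition isometry_mult :: "('a::complex_inner \<Rightarrow> 'a) \<Rightarrow> enat" where
  "isometry_mult S = cdim (kernel (cadjoint S))"

definition pure_isopair :: "('a::complex_inner \<Rightarrow> 'a) \<Rightarrow> ('a \<Rightarrow> 'a) \<Rightarrow> bool" where
  "pure_isopair S T \<longleftrightarrow> pure_isometry S \<and> pure_isometry T \<and> S \<circ> T = T \<circ> S"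

definition pure_poly_isopair ::
  "complex poly poly \<Rightarrow> ('a::complex_inner \<Rightarrow> 'a) \<Rightarrow> ('a \<Rightarrow> 'a) \<Rightarrow> bool" where
  "pure_poly_isopair q S T \<longleftrightarrow> pure_isopair S T \<and> q \<noteq> 0 \<and> (\<forall>x. poly_op q S T x = 0)"

definition bimultiplicity :: "('a::complex_inner \<Rightarrow> 'a) \<Rightarrow> ('a \<Rightarrow> 'a) \<Rightarrow> enat \<times> enat" where
  "bimultiplicity S T = (isometry_mult S, isometry_mult T)"

definition finite_bimultiplicity :: "('a::complex_inner \<Rightarrow> 'a) \<Rightarrow> ('a \<Rightarrow> 'a) \<Rightarrow> bool" where
  "finite_bimultiplicity S T \<longleftrightarrow>
     fst (bimultiplicity S T) \<noteq> \<infinity> \<and> snd (bimultiplicity S T) \<noteq> \<infinity>"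

text \<open>The minimal polynomial is determined only up to a nonzero constant factor, so it is
  a relation rather than a function.\<close>

definition minimal_polynomial ::
  "('a::complex_inner \<Rightarrow> 'a) \<Rightarrow> ('a \<Rightarrow> 'a) \<Rightarrow> complex poly poly \<Rightarrow> bool" where
  "minimal_polynomial S T p \<longleftrightarrow>
     squarefree p \<and> inner_toral p \<and> (\<forall>x. poly_op p S T x = 0) \<and>
     (\<forall>q. (\<forall>x. poly_op q S T x = 0) \<longrightarrow> p dvd q)"

text \<open>Here \<open>P 1, \<dots>, P s\<close> are the irreducible factors of the minimal polynomial \<open>p\<close>.  The
  relation determines \<open>\<alpha>\<close> on \<open>{1..s}\<close>: an irreducible factor of a square free inner toral
  polynomial has regular points in the bidisk.\<close>

definition has_rank ::
  "('a::complex_inner \<Rightarrow> 'a) \<Rightarrow> ('a \<Rightarrow> 'a) \<Rightarrow> complex poly poly \<Rightarrow> nat \<Rightarrow>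
     (nat \<Rightarrow> complex poly poly) \<Rightarrow> (nat \<Rightarrow> nat) \<Rightarrow> bool" where
  "has_rank S T p s P \<alpha> \<longleftrightarrow>
     (\<forall>j\<in>{1..s}. 0 < \<alpha> j \<and>
        (\<forall>(l, m)\<in>inner_variety (P j). regular_point p l m \<longrightarrow>
           cdim (kernel (cadjoint (\<lambda>x. S x - l *\<^sub>C x)) \<inter>
                 kernel (cadjoint (\<lambda>x. T x - m *\<^sub>C x))) = enat (\<alpha> j)))"


section \<open>Cyclicity\<close>

text \<open>The family \<open>f 1, \<dots>, f k\<close> is the restriction of \<open>f\<close> to \<open>{1..k}\<close>.\<close>

definition generated_subspace ::
  "('a::complex_inner \<Rightarrow> 'a) \<Rightarrow> ('a \<Rightarrow> 'a) \<Rightarrow> nat \<Rightarrow> (nat \<Rightarrow> 'a) \<Rightarrow> 'a set" where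
  "generated_subspace S T k f = closure {(\<Sum>j=1..k. poly_op (q j) S T (f j)) |q. True}"

definition at_most_nearly_cyclic ::
  "('a::complex_inner \<Rightarrow> 'a) \<Rightarrow> ('a \<Rightarrow> 'a) \<Rightarrow> nat \<Rightarrow> bool" where
  "at_most_nearly_cyclic S T k \<longleftrightarrow>
     (\<exists>f. inj_on f {1..k} \<and> finite_codim (generated_subspace S T k f))"

definition at_least_nearly_cyclic ::
  "('a::complex_inner \<Rightarrow> 'a) \<Rightarrow> ('a \<Rightarrow> 'a) \<Rightarrow> nat \<Rightarrow> bool" where
  "at_least_nearly_cyclic S T k \<longleftrightarrow>
     (\<forall>l<k. \<forall>f. \<not> finite_codim (generated_subspace S T l f))"

definition nearly_cyclic ::
  "('a::complex_inner \<Rightarrow> 'a) \<Rightarrow> ('a \<Rightarrow> 'a) \<Rightarrow> nat \<Rightarrow> bool" where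
  "nearly_cyclic S T k \<longleftrightarrow> at_most_nearly_cyclic S T k \<and> at_least_nearly_cyclic S T k"

end

theory Submission
  imports Defs "HOL-Computational_Algebra.Field_as_Ring"
begin

text \<open>
  Write \<open>E = ker S\<^sup>*\<close>, \<open>N = dim E\<close>, let \<open>M\<close> be the span of all \<open>S\<^sup>n E\<close>, which is dense because \<open>S\<close> is
  pure, and let \<open>J(l,m) = ker (S - l)\<^sup>* \<inter> ker (T - m)\<^sup>*\<close>.  A vector \<open>g\<close> of \<open>J(l,m)\<close> evaluates polynomials:
  \<open>\<langle>q(S,T) f, g\<rangle> = q(l,m) \<langle>f, g\<rangle>\<close>.  Let \<open>k\<close> be the largest entry of the rank.

  Since \<open>p\<close> is square free and, being inner toral, has no factor in \<open>z\<close> alone, the polynomial \<open>p(l,w)\<close> has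
  only simple roots for all but finitely many \<open>l\<close> (\<open>cofinitely_many_slices_squarefree\<close>).  For such \<open>l\<close> in
  the disk, every zero \<open>(l,m)\<close> of \<open>p\<close> is a regular point in the bidisk, so the rank gives the
  dimension of \<open>J(l,m)\<close>.

  \<^emph>\<open>Fewer than \<open>k\<close> vectors do not suffice.\<close>  Over a factor of rank \<open>k\<close> there are infinitely many \<open>l\<close> with
  some \<open>J(l,m)\<close> of dimension \<open>k\<close>.  Each contains a nonzero vector orthogonal to fewer than \<open>k\<close> given
  vectors, hence orthogonal to the subspace they generate; these eigenvectors of \<open>S\<^sup>*\<close> for distinct
  eigenvalues are independent, so the orthogonal complement is infinite dimensional
  (\<open>at_least_nearly_cyclic_if_large_eigenspaces\<close>).

  \<^emph>\<open>\<open>k\<close> vectors suffice.\<close>  In the model of \<open>S\<close> as multiplication by \<open>z\<close> on vector valued power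
  series, \<open>M\<close> consists of the polynomials.  There \<open>T\<close> multiplies by a matrix function, and finite
  multiplicity of \<open>T\<close> makes this function rational: some \<open>Q(S) T\<close> maps \<open>M\<close> into itself
  (\<open>common_denominator\<close>).  Fix one generic \<open>l\<close> with \<open>Q(l) \<noteq> 0\<close>.  As \<open>p(l,w)\<close> has simple roots, \<open>T\<^sup>*\<close> is
  diagonalisable on \<open>ker (S - l)\<^sup>*\<close>, which has dimension \<open>N\<close>, and its eigenspaces \<open>J(l,m)\<close> have dimension at
  most \<open>k\<close>.  So \<open>k\<close> vectors can be chosen in \<open>E\<close> that generate the fibre over \<open>l\<close>: applying to them
  suitable polynomials in \<open>T\<close>, and powers of \<open>Q(S)\<close> to return to \<open>M\<close>, gives \<open>N\<close> vectors of \<open>M\<close> dual to an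
  eigenbasis of \<open>ker (S - l)\<^sup>*\<close>.  Being independent in one fibre they are independent over \<open>\<complex>[S]\<close>
  (\<open>shifts_independent\<close>), and since \<open>M\<close> has rank \<open>N\<close> over \<open>\<complex>[S]\<close>, they generate a submodule of finite
  codimension (\<open>shift_span_finite_codim\<close>).  Density of \<open>M\<close> then gives finite codimension in the Hilbert
  space.
\<close>

section \<open>Inner products, projections and adjoints\<close>

lemma cinner_zero_left [simp]: "cinner 0 y = 0"
  using cinner_add_left[of 0 0 y] by simp

lemma cinner_zero_right [simp]: "cinner x 0 = 0"
  by (subst cinner_commute) simp

lemma cinner_add_right: "cinner x (y + z) = cinner x y + cinner x z"
  using cinner_commute[of x "y + z"] cinner_commute[of x y] cinner_commute[of x z]
  by (simp add: cinner_add_left)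

lemma cinner_scaleC_right: "cinner x (a *\<^sub>C y) = cnj a * cinner x y"
  using cinner_commute[of x "a *\<^sub>C y"] cinner_commute[of x y]
  by (simp add: cinner_scaleC_left)

lemma cinner_minus_left: "cinner (- x) y = - cinner x y"
  using cinner_add_left[of x "- x" y] by (simp add: eq_neg_iff_add_eq_0 add.commute)

lemma cinner_minus_right: "cinner x (- y) = - cinner x y"
  using cinner_add_right[of x y "- y"] by (simp add: eq_neg_iff_add_eq_0 add.commute)

lemma cinner_diff_left: "cinner (x - y) z = cinner x z - cinner y z"
  using cinner_add_left[of x "- y" z] by (simp add: cinner_minus_left)

lemma cinner_diff_right: "cinner z (x - y) = cinner z x - cinner z y"
  using cinner_add_right[of z x "- y"] by (simp add: cinner_minus_right)

lemma cinner_sum_left: "cinner (\<Sum>i\<in>A. f i) y = (\<Sum>i\<in>A. cinner (f i) y)"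
  by (induction A rule: infinite_finite_induct) (simp_all add: cinner_add_left)

lemma cinner_sum_right: "cinner y (\<Sum>i\<in>A. f i) = (\<Sum>i\<in>A. cinner y (f i))"
  by (induction A rule: infinite_finite_induct) (simp_all add: cinner_add_right)

lemma cinner_eq_zero_iff [simp]: "cinner x x = 0 \<longleftrightarrow> x = 0"
  by (simp add: cinner_same)

lemma cinner_ext: "(\<And>x. cinner x y = cinner x z) \<Longrightarrow> y = z"
  using cinner_eq_zero_iff[of "y - z"] by (simp add: cinner_diff_right)

lemma scaleC_one [simp]: "1 *\<^sub>C x = (x :: 'a::complex_inner)"
  by (rule complex_vector.scale_one)

lemma norm_scaleC: "norm (a *\<^sub>C x) = cmod a * norm x"
proof -
  have "complex_of_real ((norm (a *\<^sub>C x))\<^sup>2) = a * cnj a * complex_of_real ((norm x)\<^sup>2)"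
    by (simp only: cinner_same[symmetric] cinner_scaleC_left cinner_scaleC_right ac_simps)
  also have "\<dots> = complex_of_real ((cmod a * norm x)\<^sup>2)"
    by (simp only: complex_norm_square[symmetric] of_real_mult power_mult_distrib)
  finally have "(norm (a *\<^sub>C x))\<^sup>2 = (cmod a * norm x)\<^sup>2"
    by (simp only: of_real_eq_iff)
  then show ?thesis
    by (simp only: power2_eq_iff_nonneg norm_ge_zero mult_nonneg_nonneg)
qed

lemma norm_add_sq: "(norm (x + y))\<^sup>2 = (norm x)\<^sup>2 + (norm y)\<^sup>2 + 2 * Re (cinner x y)"
proof -
  have *: "(norm z)\<^sup>2 = Re (cinner z z)" for z :: 'a
    by (simp add: cinner_same)
  have "Re (cinner y x) = Re (cinner x y)"
    by (subst cinner_commute) simp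
  then show ?thesis
    by (simp add: * cinner_add_left cinner_add_right)
qed

lemma norm_diff_sq: "(norm (x - y))\<^sup>2 = (norm x)\<^sup>2 + (norm y)\<^sup>2 - 2 * Re (cinner x y)"
  using norm_add_sq[of x "- y"] by (simp add: cinner_minus_right)

text \<open>Subtracting from \<open>x\<close> its component along \<open>y\<close> shortens \<open>x\<close> by an amount that measures
  how far the two are from being orthogonal.\<close>

lemma norm_sq_diff_component:
  assumes "y \<noteq> 0"
  shows "(norm (x - (cinner x y / cinner y y) *\<^sub>C y))\<^sup>2 =
    (norm x)\<^sup>2 - (cmod (cinner x y))\<^sup>2 / (norm y)\<^sup>2"
proof -
  define a where "a = cinner x y / cinner y y"
  have ny: "norm y \<noteq> 0" using assms by simp
  have a1: "a = cinner x y / complex_of_real ((norm y)\<^sup>2)" by (simp add: a_def cinner_same)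
  have "cmod a = cmod (cinner x y) / (norm y)\<^sup>2"
    unfolding a1 norm_divide norm_of_real by simp
  then have 1: "(norm (a *\<^sub>C y))\<^sup>2 = (cmod (cinner x y))\<^sup>2 / (norm y)\<^sup>2"
    using ny by (simp add: norm_scaleC power_mult_distrib power_divide field_simps power2_eq_square)
  have "cinner x (a *\<^sub>C y) = (cinner x y * cnj (cinner x y)) / complex_of_real ((norm y)\<^sup>2)"
    by (simp add: cinner_scaleC_right a1)
  also have "\<dots> = complex_of_real ((cmod (cinner x y))\<^sup>2 / (norm y)\<^sup>2)"
    by (simp only: complex_norm_square[symmetric] of_real_divide)
  finally have "Re (cinner x (a *\<^sub>C y)) = (cmod (cinner x y))\<^sup>2 / (norm y)\<^sup>2"
    by (simp only: Re_complex_of_real)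
  then show ?thesis
    unfolding a_def[symmetric] norm_diff_sq 1 by simp
qed

lemma cinner_Cauchy_Schwarz: "cmod (cinner x y) \<le> norm x * norm y"
proof (cases "y = 0")
  case False
  have "0 \<le> (norm x)\<^sup>2 - (cmod (cinner x y))\<^sup>2 / (norm y)\<^sup>2"
    unfolding norm_sq_diff_component[OF False, symmetric] by simp
  then have "(cmod (cinner x y))\<^sup>2 \<le> (norm x * norm y)\<^sup>2"
    using False by (simp add: power_mult_distrib pos_divide_le_eq)
  then show ?thesis
    by (rule power2_le_imp_le) simp
qed simp

lemma bounded_linear_cinner_left: "bounded_linear (\<lambda>x. cinner x y)"
  by (rule bounded_linear_intro[where K = "norm y"])
    (simp_all add: cinner_add_left scaleR_scaleC cinner_scaleC_left scaleR_conv_of_real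
      cinner_Cauchy_Schwarz)

lemmas continuous_cinner_left = bounded_linear.continuous_on[OF bounded_linear_cinner_left]

lemma bounded_linear_scaleC: "bounded_linear (\<lambda>x :: 'a::complex_inner. a *\<^sub>C x)"
  by (rule bounded_linear_intro[where K = "cmod a"])
    (simp_all add: scaleC_add_right scaleR_scaleC scaleC_scaleC mult.commute norm_scaleC)

lemma bounded_linear_scaleC_left: "bounded_linear (\<lambda>a. a *\<^sub>C (x :: 'a::complex_inner))"
  by (rule bounded_linear_intro[where K = "norm x"])
    (simp_all add: scaleC_add_left scaleR_scaleC scaleC_scaleC norm_scaleC scaleR_conv_of_real)

abbreviation csubspace :: "'a::complex_inner set \<Rightarrow> bool" where
  "csubspace \<equiv> complex_vector.subspace"

abbreviation cspan :: "'a::complex_inner set \<Rightarrow> 'a set" where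
  "cspan \<equiv> complex_vector.span"

abbreviation cindependent :: "'a::complex_inner set \<Rightarrow> bool" where
  "cindependent \<equiv> complex_vector.independent"

definition orthocomp :: "'a::complex_inner set \<Rightarrow> 'a set" where
  "orthocomp M = {y. \<forall>x\<in>M. cinner x y = 0}"

lemma subspace_orthocomp: "csubspace (orthocomp M)"
  by (auto simp: complex_vector.subspace_def orthocomp_def cinner_add_right cinner_scaleC_right)

lemma orthocomp_antimono: "M \<subseteq> N \<Longrightarrow> orthocomp N \<subseteq> orthocomp M"
  by (auto simp: orthocomp_def)

lemma orthocomp_closure: "orthocomp (closure M) = orthocomp M"
proof
  show "orthocomp (closure M) \<subseteq> orthocomp M"
    by (rule orthocomp_antimono) (rule closure_subset)
  show "orthocomp M \<subseteq> orthocomp (closure M)"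
  proof
    fix y assume y: "y \<in> orthocomp M"
    have "closed {x. cinner x y = 0}"
      by (intro closed_Collect_eq continuous_cinner_left continuous_on_id continuous_on_const)
    then have "closure M \<subseteq> {x. cinner x y = 0}"
      using y by (intro closure_minimal) (auto simp: orthocomp_def)
    then show "y \<in> orthocomp (closure M)"
      by (auto simp: orthocomp_def)
  qed
qed

lemma orthocomp_span: "orthocomp (cspan M) = orthocomp M"
proof
  show "orthocomp (cspan M) \<subseteq> orthocomp M"
    by (rule orthocomp_antimono) (rule complex_vector.span_superset)
  show "orthocomp M \<subseteq> orthocomp (cspan M)"
  proof
    fix y assume y: "y \<in> orthocomp M"
    have "csubspace {x. cinner x y = 0}"
      by (auto simp: complex_vector.subspace_def cinner_add_left cinner_scaleC_left)
    then have "cspan M \<subseteq> {x. cinner x y = 0}"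
      using y by (intro complex_vector.span_minimal) (auto simp: orthocomp_def)
    then show "y \<in> orthocomp (cspan M)"
      by (auto simp: orthocomp_def)
  qed
qed

lemma orthocomp_self: "x \<in> M \<Longrightarrow> x \<in> orthocomp M \<Longrightarrow> x = 0"
  by (auto simp: orthocomp_def)

lemma subspace_closure:
  assumes "csubspace M"
  shows "csubspace (closure M)"
proof (rule complex_vector.subspaceI)
  show "0 \<in> closure M"
    using assms closure_subset complex_vector.subspace_0 by blast
  show "x + y \<in> closure M" if xy: "x \<in> closure M" "y \<in> closure M" for x y
  proof -
    obtain f g where "\<And>n. f n \<in> M" "f \<longlonglongrightarrow> x" "\<And>n. g n \<in> M" "g \<longlonglongrightarrow> y"
      using xy by (auto simp: closure_sequential)
    then have "(\<lambda>n. f n + g n) \<longlonglongrightarrow> x + y" "\<And>n. f n + g n \<in> M"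
      using assms by (auto intro: tendsto_add complex_vector.subspace_add)
    then show ?thesis
      unfolding closure_sequential by (intro exI[of _ "\<lambda>n. f n + g n"] conjI allI)
  qed
  show "c *\<^sub>C x \<in> closure M" if x: "x \<in> closure M" for x c
  proof -
    obtain f where "\<And>n. f n \<in> M" "f \<longlonglongrightarrow> x"
      using x by (auto simp: closure_sequential)
    then have "(\<lambda>n. c *\<^sub>C f n) \<longlonglongrightarrow> c *\<^sub>C x" "\<And>n. c *\<^sub>C f n \<in> M"
      using assms bounded_linear.tendsto[OF bounded_linear_scaleC]
      by (auto intro: complex_vector.subspace_scale)
    then show ?thesis
      unfolding closure_sequential by (intro exI[of _ "\<lambda>n. c *\<^sub>C f n"] conjI allI)
  qed
qed

text \<open>The vector of \<open>K\<close> nearest to \<open>x\<close> is the limit of a minimising sequence, which is Cauchy by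
  the parallelogram law; moving from it in a direction \<open>y\<close> of \<open>K\<close> cannot come nearer to \<open>x\<close>, which
  forces \<open>x - k\<close> to be orthogonal to \<open>y\<close>.\<close>

lemma orthogonal_projection_exists:
  fixes K :: "'a::chilbert_space set"
  assumes "closed K" and sub: "csubspace K"
  shows "\<exists>k\<in>K. x - k \<in> orthocomp K"
proof -
  define D where "D = (\<lambda>k. (norm (x - k))\<^sup>2) ` K"
  define d where "d = Inf D"
  have "0 \<in> K" using sub by (rule complex_vector.subspace_0)
  then have ne: "D \<noteq> {}" by (auto simp: D_def)
  have bdd: "bdd_below D" by (rule bdd_belowI[of _ 0]) (auto simp: D_def)
  have dle: "d \<le> (norm (x - k))\<^sup>2" if "k \<in> K" for k
    unfolding d_def using that bdd by (intro cInf_lower) (auto simp: D_def)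
  have "\<exists>k\<in>K. (norm (x - k))\<^sup>2 < d + inverse (real (Suc n))" for n
    using cInf_lessD[OF ne, of "d + inverse (real (Suc n))"] by (auto simp: D_def d_def)
  then obtain k where k: "\<And>n. k n \<in> K"
    and kd: "\<And>n. (norm (x - k n))\<^sup>2 < d + inverse (real (Suc n))"
    by metis
  have cau: "(norm (k m - k n))\<^sup>2 \<le> 2 * inverse (real (Suc m)) + 2 * inverse (real (Suc n))" for m n
  proof -
    \<comment> \<open>The midpoint lies in \<open>K\<close>, so it is no nearer to \<open>x\<close> than the infimum allows.\<close>
    have "(1/2) *\<^sub>C (k m + k n) \<in> K"
      using sub k by (intro complex_vector.subspace_scale complex_vector.subspace_add)
    note d = dle[OF this]
    have "2 *\<^sub>C (x - (1/2) *\<^sub>C (k m + k n)) = 2 *\<^sub>C x - (k m + k n)"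
      by (simp only: complex_vector.scale_right_diff_distrib scaleC_scaleC) simp
    also have "2 *\<^sub>C x = x + x"
      using scaleC_add_left[of 1 1 x] by simp
    finally have "(x - k m) + (x - k n) = 2 *\<^sub>C (x - (1/2) *\<^sub>C (k m + k n))"
      by (simp only: add_diff_add)
    then have "(norm ((x - k m) + (x - k n)))\<^sup>2 = 4 * (norm (x - (1/2) *\<^sub>C (k m + k n)))\<^sup>2"
      by (simp add: norm_scaleC power_mult_distrib)
    with d have "4 * d \<le> (norm ((x - k m) + (x - k n)))\<^sup>2" by simp
    moreover have "(norm ((x - k m) - (x - k n)))\<^sup>2 = (norm (k m - k n))\<^sup>2"
      by (simp add: norm_minus_commute)
    ultimately show ?thesis
      using norm_add_sq[of "x - k m" "x - k n"] norm_diff_sq[of "x - k m" "x - k n"]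
        kd[of m] kd[of n] by linarith
  qed
  have "Cauchy k"
  proof (rule CauchyI)
    fix e :: real assume e: "e > 0"
    then obtain M where M: "inverse (real (Suc M)) < e\<^sup>2 / 4"
      using reals_Archimedean[of "e\<^sup>2 / 4"] by auto
    have "norm (k m - k n) < e" if "m \<ge> M" "n \<ge> M" for m n
    proof -
      have "inverse (real (Suc m)) \<le> inverse (real (Suc M))" "inverse (real (Suc n)) \<le> inverse (real (Suc M))"
        using that by (simp_all add: le_imp_inverse_le)
      with M cau[of m n] have "(norm (k m - k n))\<^sup>2 < e\<^sup>2" by linarith
      then show ?thesis by (rule power2_less_imp_less) (use e in simp)
    qed
    then show "\<exists>M. \<forall>m\<ge>M. \<forall>n\<ge>M. norm (k m - k n) < e" by blast
  qed
  then obtain l where l: "k \<longlonglongrightarrow> l"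
    using Cauchy_convergent_iff convergent_def by blast
  have lK: "l \<in> K"
    using \<open>closed K\<close> k l closed_sequentially by blast
  have "(\<lambda>n. (norm (x - k n))\<^sup>2) \<longlonglongrightarrow> (norm (x - l))\<^sup>2"
    by (intro tendsto_intros l)
  moreover have "(\<lambda>n. d + inverse (real (Suc n))) \<longlonglongrightarrow> d + 0"
    by (intro tendsto_intros LIMSEQ_inverse_real_of_nat)
  ultimately have "(norm (x - l))\<^sup>2 \<le> d + 0"
    by (rule LIMSEQ_le) (use kd less_imp_le in blast)
  then have ld: "(norm (x - l))\<^sup>2 \<le> d" by simp
  have "cinner (x - l) y = 0" if y: "y \<in> K" for y
  proof (cases "y = 0")
    case False
    define c where "c = cinner (x - l) y / cinner y y"
    have "l + c *\<^sub>C y \<in> K"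
      using sub lK y by (intro complex_vector.subspace_scale complex_vector.subspace_add)
    from dle[OF this] have "d \<le> (norm (x - l - c *\<^sub>C y))\<^sup>2" by (simp add: diff_diff_eq)
    then have "(cmod (cinner (x - l) y))\<^sup>2 / (norm y)\<^sup>2 \<le> 0"
      using ld unfolding c_def norm_sq_diff_component[OF False] by linarith
    then show ?thesis using False by (simp add: divide_le_0_iff)
  qed simp
  then have "x - l \<in> orthocomp K"
    unfolding orthocomp_def using cinner_commute[of _ "x - l"] by simp
  with lK show ?thesis by blast
qed

lemma closed_subspace_eq_UNIV:
  fixes K :: "'a::chilbert_space set"
  assumes "closed K" "csubspace K" "orthocomp K \<subseteq> {0}"
  shows "K = UNIV"
proof -
  have "x \<in> K" for x
    using orthogonal_projection_exists[OF assms(1,2), of x] assms(3) by force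
  then show ?thesis by blast
qed

text \<open>Replacing \<open>b\<close> by its component orthogonal to \<open>K\<close>, the coefficient of \<open>b\<close> can be recovered
  continuously by an inner product.\<close>

lemma closed_span_insert:
  fixes K :: "'a::chilbert_space set"
  assumes "closed K" and sub: "csubspace K"
  shows "closed (cspan (insert b K))"
proof -
  obtain k where k: "k \<in> K" and bk: "b - k \<in> orthocomp K"
    using orthogonal_projection_exists[OF assms] by blast
  define u where "u = b - k"
  have span: "cspan (insert b K) = {x. \<exists>c. x - c *\<^sub>C u \<in> K}"
  proof -
    have "x - c *\<^sub>C b \<in> K \<longleftrightarrow> x - c *\<^sub>C u \<in> K" for x c
    proof -
      have eq: "x - c *\<^sub>C u = (x - c *\<^sub>C b) + c *\<^sub>C k"
        by (simp add: u_def complex_vector.scale_right_diff_distrib)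
      have ck: "c *\<^sub>C k \<in> K" using sub k by (rule complex_vector.subspace_scale)
      then show ?thesis
        unfolding eq using complex_vector.subspace_add[OF sub, of _ "c *\<^sub>C k"]
          complex_vector.subspace_diff[OF sub, of "x - c *\<^sub>C b + c *\<^sub>C k" "c *\<^sub>C k"] by auto
    qed
    moreover have "cspan K = K" by (rule complex_vector.span_eq_iff[THEN iffD2, OF sub])
    ultimately show ?thesis
      by (simp only: complex_vector.span_insert)
  qed
  show ?thesis
  proof (cases "u = 0")
    case True
    then show ?thesis using \<open>closed K\<close> by (simp add: span)
  next
    case False
    have coeff: "c = cinner x u / cinner u u" if "x - c *\<^sub>C u \<in> K" for x c
    proof -
      have "cinner (x - c *\<^sub>C u) u = 0"
        using that bk by (auto simp: orthocomp_def u_def)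
      then show ?thesis using False
        by (simp add: cinner_diff_left cinner_scaleC_left)
    qed
    have "cspan (insert b K) = (\<lambda>x. x - (cinner x u / cinner u u) *\<^sub>C u) -` K"
      using coeff by (auto simp: span)
    moreover have "continuous_on UNIV (\<lambda>x. x - (cinner x u / cinner u u) *\<^sub>C u)"
      using False
      by (intro continuous_on_diff continuous_on_id bounded_linear.continuous_on[OF bounded_linear_scaleC_left]
          continuous_on_divide continuous_on_const continuous_cinner_left) auto
    ultimately show ?thesis
      using \<open>closed K\<close> by (simp add: closed_vimage)
  qed
qed

lemma closed_span_Un_finite:
  fixes K :: "'a::chilbert_space set"
  assumes "closed K" and sub: "csubspace K" and "finite B"
  shows "closed (cspan (K \<union> B))"
  using \<open>finite B\<close>
proof induction
  case empty
  then show ?case using assms by (simp add: complex_vector.span_eq_iff[THEN iffD2])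
next
  case (insert b B)
  have "cspan (K \<union> insert b B) = cspan (insert b (cspan (K \<union> B)))"
    by (simp add: complex_vector.span_insert complex_vector.span_span)
  then show ?case
    using closed_span_insert[OF insert.IH complex_vector.subspace_span] by simp
qed

lemma closed_span_finite:
  fixes B :: "'a::chilbert_space set"
  shows "finite B \<Longrightarrow> closed (cspan B)"
  using closed_span_Un_finite[of "{0}" B] by (simp add: complex_vector.subspace_single_0)

text \<open>The kernel of a nonzero functional has codimension one, so the representing vector must be a multiple
  of any vector orthogonal to the kernel.\<close>

lemma Riesz_representation:
  fixes \<phi> :: "'a::chilbert_space \<Rightarrow> complex"
  assumes bl: "bounded_linear \<phi>" and sc: "\<And>a x. \<phi> (a *\<^sub>C x) = a * \<phi> x"
  shows "\<exists>z. \<forall>x. \<phi> x = cinner x z"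
proof (cases "\<forall>x. \<phi> x = 0")
  case True
  then show ?thesis by (intro exI[of _ 0]) simp
next
  case False
  then obtain x0 where x0: "\<phi> x0 \<noteq> 0" by blast
  interpret \<phi>: bounded_linear \<phi> by (rule bl)
  define K where "K = {x. \<phi> x = 0}"
  have "closed K"
    unfolding K_def by (intro closed_Collect_eq \<phi>.continuous_on continuous_on_id continuous_on_const)
  moreover have "csubspace K"
    by (auto simp: K_def complex_vector.subspace_def \<phi>.zero \<phi>.add sc)
  ultimately obtain k where k: "k \<in> K" "x0 - k \<in> orthocomp K"
    using orthogonal_projection_exists by blast
  define u where "u = x0 - k"
  have \<phi>u: "\<phi> u \<noteq> 0" using k x0 by (simp add: u_def \<phi>.diff K_def)
  then have "u \<noteq> 0" using \<phi>.zero by auto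
  have "\<phi> x = cinner x (cnj (\<phi> u / cinner u u) *\<^sub>C u)" for x
  proof -
    have "x - (\<phi> x / \<phi> u) *\<^sub>C u \<in> K"
      using \<phi>u by (simp add: K_def \<phi>.diff sc)
    then have "cinner (x - (\<phi> x / \<phi> u) *\<^sub>C u) u = 0"
      using k by (simp add: orthocomp_def u_def)
    then have "cinner x u = \<phi> x / \<phi> u * cinner u u"
      by (simp add: cinner_diff_left cinner_scaleC_left)
    then show ?thesis using \<open>u \<noteq> 0\<close> \<phi>u by (simp add: cinner_scaleC_right)
  qed
  then show ?thesis by blast
qed

lemma clinear_add: "clinear f \<Longrightarrow> f (x + y) = f x + f y"
  unfolding clinear_def by (rule Vector_Spaces.linear.axioms(3)[THEN module_hom.add, of _ _ f]) 

lemma clinear_scaleC: "clinear f \<Longrightarrow> f (a *\<^sub>C x) = a *\<^sub>C f x"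
  unfolding clinear_def by (rule Vector_Spaces.linear.axioms(3)[THEN module_hom.scale, of _ _ f])

lemma clinearI:
  "(\<And>x y. f (x + y) = f x + f y) \<Longrightarrow> (\<And>a x. f (a *\<^sub>C x) = a *\<^sub>C f x) \<Longrightarrow> clinear f"
  unfolding clinear_def by unfold_locales auto

lemma clinear_zero: "clinear f \<Longrightarrow> f 0 = 0"
  using clinear_scaleC[of f 0 0] by simp

lemma clinear_diff: "clinear f \<Longrightarrow> f (x - y) = f x - f y"
  using clinear_add[of f "x - y" y] by simp

lemma clinear_sum: "clinear f \<Longrightarrow> f (\<Sum>i\<in>A. g i) = (\<Sum>i\<in>A. f (g i))"
  by (induction A rule: infinite_finite_induct) (auto simp: clinear_zero clinear_add)

definition bounded_clinear :: "('a::complex_inner \<Rightarrow> 'b::complex_inner) \<Rightarrow> bool" where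
  "bounded_clinear f \<longleftrightarrow> clinear f \<and> (\<exists>K. \<forall>x. norm (f x) \<le> K * norm x)"

lemma cinner_cadjoint:
  fixes f :: "'a::chilbert_space \<Rightarrow> 'b::complex_inner"
  assumes "bounded_clinear f"
  shows "cinner (f x) y = cinner x (cadjoint f y)"
proof -
  obtain K where lin: "clinear f" and K: "\<And>x. norm (f x) \<le> K * norm x"
    using assms by (auto simp: bounded_clinear_def)
  have "\<exists>z. \<forall>x. cinner (f x) y = cinner x z" for y
  proof (rule Riesz_representation)
    have "norm (f x) \<le> norm x * K" for x
      using K[of x] by (simp add: mult.commute)
    then have "bounded_linear f"
      by (intro bounded_linear_intro[where K = K])
        (simp_all add: scaleR_scaleC clinear_add clinear_scaleC lin)
    then show "bounded_linear (\<lambda>x. cinner (f x) y)"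
      by (rule bounded_linear_compose[OF bounded_linear_cinner_left])
  qed (simp add: clinear_scaleC lin cinner_scaleC_left)
  then obtain g where "\<forall>x y. cinner (f x) y = cinner x (g y)" by metis
  then have "\<forall>x y. cinner (f x) y = cinner x (cadjoint f y)"
    unfolding cadjoint_def by (rule someI[where P = "\<lambda>g. \<forall>x y. cinner (f x) y = cinner x (g y)"])
  then show ?thesis by blast
qed

lemma kernel_cadjoint:
  fixes f :: "'a::chilbert_space \<Rightarrow> 'b::complex_inner"
  assumes "bounded_clinear f"
  shows "kernel (cadjoint f) = orthocomp (range f)"
  unfolding kernel_def orthocomp_def
  using cinner_cadjoint[OF assms] cinner_ext[of "cadjoint f _" 0] by auto

lemma clinear_cadjoint:
  fixes f :: "'a::chilbert_space \<Rightarrow> 'b::complex_inner"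
  assumes "bounded_clinear f"
  shows "clinear (cadjoint f)"
  by (rule clinearI; rule cinner_ext)
    (simp_all add: cinner_add_right cinner_scaleC_right flip: cinner_cadjoint[OF assms])

section \<open>Finite dimensional linear algebra\<close>

interpretation complex_vector_pair:
  vector_space_pair "scaleC :: complex \<Rightarrow> 'a \<Rightarrow> 'a::complex_inner"
    "scaleC :: complex \<Rightarrow> 'b \<Rightarrow> 'b::complex_inner"
  by unfold_locales

lemma cdim_enatE:
  assumes "cdim M = enat n"
  obtains B where "B \<subseteq> M" "cindependent B" "M \<subseteq> cspan B" "finite B" "card B = n"
proof -
  obtain B0 where B0: "finite B0" "M \<subseteq> cspan B0" and n: "complex_vector.dim M = n"
    using assms by (auto simp: cdim_def split: if_splits)
  obtain B where B: "B \<subseteq> M" "cindependent B" "M \<subseteq> cspan B" "card B = complex_vector.dim M"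
    using complex_vector.basis_exists by blast
  moreover have "finite B"
    using complex_vector.independent_span_bound[OF B0(1) B(2)] B(1) B0(2) by blast
  ultimately show ?thesis using that n by blast
qed

text \<open>Up to scaling, the vector dual to \<open>v\<close> is the component of \<open>v\<close> orthogonal to the span of the others.\<close>

lemma dual_basis_exists:
  fixes B :: "'a::chilbert_space set"
  assumes "finite B" "cindependent B"
  obtains u where "\<And>v. v \<in> B \<Longrightarrow> u v \<in> cspan B"
    "\<And>v v'. v \<in> B \<Longrightarrow> v' \<in> B \<Longrightarrow> cinner (u v) v' = (if v = v' then 1 else 0)"
proof -
  have "\<exists>u\<in>cspan B. \<forall>v'\<in>B. cinner u v' = (if v = v' then 1 else 0)" if v: "v \<in> B" for v
  proof -
    let ?K = "cspan (B - {v})"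
    obtain k where k: "k \<in> ?K" "v - k \<in> orthocomp ?K"
      using orthogonal_projection_exists[OF closed_span_finite complex_vector.subspace_span] assms(1)
      by (metis finite_Diff)
    define w where "w = v - k"
    have "w \<noteq> 0"
      using k v assms(2) by (auto simp: w_def complex_vector.dependent_def)
    have wB: "w \<in> cspan B"
      using k(1) v complex_vector.span_mono[of "B - {v}" B]
      unfolding w_def by (intro complex_vector.span_diff) (auto intro: complex_vector.span_base)
    have ort: "cinner w x = 0" if "x \<in> ?K" for x
    proof -
      have "cinner x w = 0" using that k by (auto simp: w_def orthocomp_def)
      then show ?thesis by (subst cinner_commute) simp
    qed
    have "cinner w v = cinner w (w + k)" by (simp add: w_def)
    also have "\<dots> = cinner w w" using ort k by (simp add: cinner_add_right)
    finally have wv: "cinner w v = cinner w w" .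
    show ?thesis
    proof (intro bexI ballI)
      show "(1 / cinner w w) *\<^sub>C w \<in> cspan B"
        using wB by (rule complex_vector.span_scale)
      show "cinner ((1 / cinner w w) *\<^sub>C w) v' = (if v = v' then 1 else 0)" if "v' \<in> B" for v'
        using that ort[of v'] complex_vector.span_base[of v' "B - {v}"] \<open>w \<noteq> 0\<close> wv
        by (auto simp: cinner_scaleC_left)
    qed
  qed
  then show ?thesis using that by metis
qed

text \<open>If there were no such vector, the orthogonal projection onto the span of \<open>A\<close> would be injective on
  the span of \<open>C\<close> and would embed it in a space of smaller dimension.\<close>

lemma nonzero_orthogonal_to_few:
  fixes C :: "'a::chilbert_space set"
  assumes "cindependent C" "finite C" "finite A" "card A < card C"
  obtains g where "g \<in> cspan C" "g \<noteq> 0" "\<And>a. a \<in> A \<Longrightarrow> cinner a g = 0"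
proof -
  have "\<exists>P. clinear P \<and> (\<forall>x. P x \<in> cspan A \<and> x - P x \<in> orthocomp (cspan A))"
  proof -
    have "\<forall>x. \<exists>y. y \<in> cspan A \<and> x - y \<in> orthocomp (cspan A)"
      using orthogonal_projection_exists[OF closed_span_finite[OF assms(3)] complex_vector.subspace_span]
      by blast
    then obtain P where P: "\<And>x. P x \<in> cspan A" "\<And>x. x - P x \<in> orthocomp (cspan A)" by metis
    have uniq: "y = P x" if "y \<in> cspan A" "x - y \<in> orthocomp (cspan A)" for x y
    proof -
      have "y - P x \<in> cspan A" using that P by (simp add: complex_vector.span_diff)
      moreover have "(x - P x) - (x - y) \<in> orthocomp (cspan A)"
        using that P subspace_orthocomp complex_vector.subspace_diff by blast
      ultimately have "y - P x = 0" using orthocomp_self by (metis diff_diff_eq2 diff_add_cancel add_diff_cancel_left' diff_right_commute minus_diff_eq)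
      then show ?thesis by simp
    qed
    have "clinear P"
    proof (rule clinearI)
      show "P (x + y) = P x + P y" for x y
        by (rule uniq[symmetric])
          (use P complex_vector.subspace_add[OF subspace_orthocomp P(2)[of x] P(2)[of y]] in
            \<open>auto intro: complex_vector.span_add simp: add_diff_add\<close>)
      show "P (a *\<^sub>C x) = a *\<^sub>C P x" for a x
        by (rule uniq[symmetric])
          (use P complex_vector.subspace_scale[OF subspace_orthocomp P(2)[of x], of a] in
            \<open>auto intro: complex_vector.span_scale simp: complex_vector.scale_right_diff_distrib\<close>)
    qed
    then show ?thesis using P by blast
  qed
  then obtain P where P: "clinear P" "\<And>x. P x \<in> cspan A" "\<And>x. x - P x \<in> orthocomp (cspan A)"
    by blast
  have "\<not> inj_on P (cspan C)"
  proof
    assume inj: "inj_on P (cspan C)"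
    have "cindependent (P ` C)"
      using complex_vector_pair.linear_independent_injective_image P(1) assms(1) inj
      unfolding clinear_def by blast
    then have "card (P ` C) \<le> card A"
      using complex_vector.independent_span_bound[OF assms(3)] P(2) by blast
    moreover have "card (P ` C) = card C"
      using inj complex_vector.span_superset by (metis card_image inj_on_subset)
    ultimately show False using assms(4) by simp
  qed
  then obtain x y where xy: "x \<in> cspan C" "y \<in> cspan C" "x \<noteq> y" "P x = P y"
    by (auto simp: inj_on_def)
  have "P (x - y) = 0" using xy P(1) by (simp add: clinear_diff)
  then have "x - y \<in> orthocomp (cspan A)" using P(3)[of "x - y"] by simp
  then have "cinner a (x - y) = 0" if "a \<in> A" for a
    using that complex_vector.span_base by (auto simp: orthocomp_def)
  then show ?thesis
    using xy by (intro that[of "x - y"]) (auto intro: complex_vector.span_diff)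
qed

text \<open>A complement \<open>B\<close> of \<open>K\<close> may be replaced by its projection to the orthogonal complement of \<open>K\<close>, which
  it then spans.\<close>

lemma orthocomp_finite_codim:
  fixes K :: "'a::chilbert_space set"
  assumes "closed K" and sub: "csubspace K" and "finite_codim K"
  obtains B where "finite B" "orthocomp K \<subseteq> cspan B"
proof -
  obtain B where B: "finite B" "cspan (K \<union> B) = UNIV"
    using assms(3) by (auto simp: finite_codim_def)
  obtain P where P: "\<And>x. P x \<in> K" "\<And>x. x - P x \<in> orthocomp K"
    using orthogonal_projection_exists[OF assms(1,2)] by metis
  define B' where "B' = (\<lambda>b. b - P b) ` B"
  have B'o: "cspan B' \<subseteq> orthocomp K"
    using P by (intro complex_vector.span_minimal subspace_orthocomp) (auto simp: B'_def)
  have "K \<union> B \<subseteq> cspan (K \<union> B')"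
  proof (intro Un_least subsetI)
    fix b assume "b \<in> B"
    then have "(b - P b) + P b \<in> cspan (K \<union> B')"
      using P by (intro complex_vector.span_add complex_vector.span_base) (auto simp: B'_def)
    then show "b \<in> cspan (K \<union> B')" by simp
  qed (auto intro: complex_vector.span_base)
  then have all: "cspan (K \<union> B') = UNIV"
    using complex_vector.span_minimal[OF _ complex_vector.subspace_span] B(2) by blast
  have "orthocomp K \<subseteq> cspan B'"
  proof
    fix y assume y: "y \<in> orthocomp K"
    have "y \<in> cspan (K \<union> B')" using all by simp
    then obtain k b where kb: "y = k + b" "k \<in> cspan K" "b \<in> cspan B'"
      by (auto simp: complex_vector.span_Un)
    have "k \<in> K" using kb(2) sub by (metis complex_vector.span_eq_iff)
    moreover have "y - b \<in> orthocomp K"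
      using y kb(3) B'o subspace_orthocomp complex_vector.subspace_diff by blast
    ultimately have "k = 0" using orthocomp_self kb(1) by auto
    then show "y \<in> cspan B'" using kb by simp
  qed
  then show ?thesis using that[of B'] B(1) by (simp add: B'_def)
qed

text \<open>A finite dimensional extension of the closed subspace \<open>K\<close> is closed, so it is everything as soon as it
  contains a dense subspace.\<close>

lemma finite_codim_if_dense_in_finite_extension:
  fixes K :: "'a::chilbert_space set"
  assumes "closed K" "csubspace K" "finite C" "M \<subseteq> cspan (K \<union> C)" "orthocomp M \<subseteq> {0}"
  shows "finite_codim K"
proof -
  have "cspan (K \<union> C) = UNIV"
    using assms orthocomp_antimono[OF assms(4)]
    by (intro closed_subspace_eq_UNIV closed_span_Un_finite complex_vector.subspace_span) auto
  then show ?thesis using assms(3) by (auto simp: finite_codim_def)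
qed

text \<open>A linear relation among the members of a sequence, recorded as a nonzero polynomial in order to let it
  act later as a polynomial in an operator.\<close>

lemma finite_dim_relation:
  fixes x :: "nat \<Rightarrow> 'a::complex_inner"
  assumes "finite B" and x: "\<And>n. x n \<in> cspan B"
  obtains q :: "complex poly" where "q \<noteq> 0" "(\<Sum>i\<le>degree q. coeff q i *\<^sub>C x i) = 0"
proof (cases "inj_on x {..card B}")
  case True
  have "\<not> cindependent (x ` {..card B})"
  proof
    assume "cindependent (x ` {..card B})"
    then have "card (x ` {..card B}) \<le> card B"
      using complex_vector.independent_span_bound[OF assms(1)] x by blast
    then show False using card_image[OF True] by simp
  qed
  then obtain c v where c: "v \<in> x ` {..card B}" "c v \<noteq> 0" "(\<Sum>v\<in>x ` {..card B}. c v *\<^sub>C v) = 0"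
    by (auto simp: complex_vector.dependent_finite)
  define q where "q = (\<Sum>i\<le>card B. monom (c (x i)) i)"
  have co: "coeff q i = (if i \<le> card B then c (x i) else 0)" for i
    by (simp add: q_def coeff_sum sum.delta)
  have "(\<Sum>i\<le>degree q. coeff q i *\<^sub>C x i) = (\<Sum>i\<le>card B. coeff q i *\<^sub>C x i)"
    by (rule sum.mono_neutral_left) (auto simp: co q_def intro!: coeff_eq_0 degree_sum_le
        order.trans[OF degree_monom_le])
  also have "\<dots> = (\<Sum>v\<in>x ` {..card B}. c v *\<^sub>C v)"
    by (simp add: sum.reindex[OF True] co)
  finally have "(\<Sum>i\<le>degree q. coeff q i *\<^sub>C x i) = 0" using c(3) by simp
  moreover have "q \<noteq> 0" using c(1,2) co by (auto simp: poly_eq_iff)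
  ultimately show ?thesis using that by blast
next
  case False
  then obtain i j where ij: "i < j" "x i = x j" by (metis inj_onI linorder_neqE_nat)
  define q where "q = monom 1 j - monom (1::complex) i"
  have co: "coeff q n = (if n = j then 1 else if n = i then -1 else 0)" for n
    using ij by (auto simp: q_def)
  have "degree q = j"
    by (rule antisym[OF degree_le le_degree]) (use ij in \<open>auto simp: co\<close>)
  moreover have "(\<Sum>n\<le>j. coeff q n *\<^sub>C x n) = (\<Sum>n\<in>{i, j}. coeff q n *\<^sub>C x n)"
    by (rule sum.mono_neutral_right) (use ij in \<open>auto simp: co\<close>)
  ultimately have "(\<Sum>n\<le>degree q. coeff q n *\<^sub>C x n) = 0"
    using ij by (simp add: co)
  moreover have "q \<noteq> 0" using co[of j] by auto
  ultimately show ?thesis using that by blast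
qed

section \<open>Polynomials in one and two operators\<close>

definition op_poly :: "complex poly \<Rightarrow> ('a::complex_inner \<Rightarrow> 'a) \<Rightarrow> 'a \<Rightarrow> 'a" where
  "op_poly q S x = (\<Sum>i\<le>degree q. coeff q i *\<^sub>C (S ^^ i) x)"

lemma op_poly_eq_sum:
  "degree q \<le> n \<Longrightarrow> op_poly q S x = (\<Sum>i\<le>n. coeff q i *\<^sub>C (S ^^ i) x)"
  unfolding op_poly_def by (rule sum.mono_neutral_left) (auto intro: coeff_eq_0)

lemma op_poly_0 [simp]: "op_poly 0 S x = 0"
  by (simp add: op_poly_def)

lemma op_poly_add: "op_poly (p + q) S x = op_poly p S x + op_poly q S x"
  using op_poly_eq_sum[of "p + q" "max (degree p) (degree q)" S x]
    op_poly_eq_sum[of p "max (degree p) (degree q)" S x]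
    op_poly_eq_sum[of q "max (degree p) (degree q)" S x]
  by (simp add: degree_add_le scaleC_add_left sum.distrib)

lemma op_poly_sum: "op_poly (\<Sum>i\<in>A. f i) S x = (\<Sum>i\<in>A. op_poly (f i) S x)"
  by (induction A rule: infinite_finite_induct) (simp_all add: op_poly_add)

lemma op_poly_smult: "op_poly (smult c p) S x = c *\<^sub>C op_poly p S x"
  using op_poly_eq_sum[of "smult c p" "degree p" S x]
  by (simp add: op_poly_def scaleC_scaleC complex_vector.scale_sum_right)

lemma op_poly_pCons:
  assumes "clinear S"
  shows "op_poly (pCons a q) S x = a *\<^sub>C x + S (op_poly q S x)"
  using op_poly_eq_sum[of "pCons a q" "Suc (degree q)" S x]
  by (simp add: degree_pCons_le sum.atMost_Suc_shift op_poly_def clinear_sum[OF assms]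
      clinear_scaleC[OF assms] del: sum.atMost_Suc)

lemma op_poly_1 [simp]: "op_poly 1 S x = x"
  by (simp add: op_poly_def)

lemma clinear_funpow: "clinear (S :: 'a::complex_inner \<Rightarrow> 'a) \<Longrightarrow> clinear (S ^^ n)"
  by (induction n) (auto intro!: clinearI simp: clinear_add clinear_scaleC)

lemma clinear_op_poly: "clinear S \<Longrightarrow> clinear (op_poly q S)"
  unfolding op_poly_def
  by (rule clinearI) (simp_all add: clinear_add clinear_scaleC clinear_funpow scaleC_add_right
      sum.distrib complex_vector.scale_sum_right scaleC_scaleC mult.commute)

lemma op_poly_mult:
  assumes "clinear S"
  shows "op_poly (p * q) S x = op_poly p S (op_poly q S x)"
  by (induction p) (simp_all add: op_poly_add op_poly_smult op_poly_pCons assms)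

lemma funpow_commute:
  assumes "\<And>x. S (T x) = T (S x)"
  shows "(S ^^ n) (T x) = T ((S ^^ n) x)"
  by (induction n) (simp_all add: assms)

lemma op_poly_commute:
  assumes "\<And>x. S (T x) = T (S x)" and "clinear T"
  shows "op_poly q S (T x) = T (op_poly q S x)"
  by (simp add: op_poly_def clinear_sum[OF assms(2)] clinear_scaleC[OF assms(2)]
      funpow_commute[of S T, OF assms(1)])

lemma cinner_funpow_eigen:
  assumes "\<And>x. cinner (S x) g = l * cinner x g"
  shows "cinner ((S ^^ n) x) g = l ^ n * cinner x g"
  by (induction n) (simp_all add: assms)

text \<open>The hypothesis says that \<open>g\<close> is an eigenvector of the adjoint of \<open>S\<close> with eigenvalue \<open>cnj l\<close>.  In this
  form neither the adjoint nor conjugated polynomials need to appear.\<close>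

lemma cinner_op_poly_eigen:
  assumes "\<And>x. cinner (S x) g = l * cinner x g"
  shows "cinner (op_poly q S x) g = poly q l * cinner x g"
  by (simp add: op_poly_def cinner_sum_left cinner_scaleC_left poly_altdef sum_distrib_right
      cinner_funpow_eigen[OF assms] mult.assoc)

lemma bounded_clinear_add:
  assumes "bounded_clinear f" "bounded_clinear g"
  shows "bounded_clinear (\<lambda>x. f x + g x)"
proof -
  obtain K L where *: "clinear f" "clinear g" "\<And>x. norm (f x) \<le> K * norm x" "\<And>x. norm (g x) \<le> L * norm x"
    using assms by (auto simp: bounded_clinear_def)
  have "norm (f x + g x) \<le> (K + L) * norm x" for x
    using norm_triangle_le[of "f x" "g x" "(K + L) * norm x"] *(3)[of x] *(4)[of x]
    by (simp add: algebra_simps)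
  moreover have "clinear (\<lambda>x. f x + g x)"
    by (rule clinearI) (simp_all add: clinear_add clinear_scaleC * scaleC_add_right)
  ultimately show ?thesis by (auto simp: bounded_clinear_def)
qed

lemma bounded_clinear_scaleC:
  assumes "bounded_clinear f"
  shows "bounded_clinear (\<lambda>x. c *\<^sub>C f x)"
proof -
  obtain K where *: "clinear f" "\<And>x. norm (f x) \<le> K * norm x"
    using assms by (auto simp: bounded_clinear_def)
  have "norm (c *\<^sub>C f x) \<le> (cmod c * K) * norm x" for x
    using mult_left_mono[OF *(2)[of x], of "cmod c"] by (simp add: norm_scaleC mult.assoc)
  moreover have "clinear (\<lambda>x. c *\<^sub>C f x)"
    by (rule clinearI) (simp_all add: clinear_add clinear_scaleC * scaleC_add_right scaleC_scaleC mult.commute)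
  ultimately show ?thesis by (auto simp: bounded_clinear_def)
qed

lemma bounded_clinear_compose:
  assumes "bounded_clinear f" "bounded_clinear g"
  shows "bounded_clinear (\<lambda>x. f (g x))"
proof -
  obtain K L where *: "clinear f" "clinear g" "\<And>x. norm (f x) \<le> K * norm x" "\<And>x. norm (g x) \<le> L * norm x"
    using assms by (auto simp: bounded_clinear_def)
  have "norm (f (g x)) \<le> (\<bar>K\<bar> * L) * norm x" for x
  proof -
    have "norm (f (g x)) \<le> \<bar>K\<bar> * norm (g x)"
      using *(3)[of "g x"] mult_right_mono[OF abs_ge_self norm_ge_zero, of K "g x"] by linarith
    also have "\<dots> \<le> \<bar>K\<bar> * (L * norm x)"
      using *(4) by (rule mult_left_mono) simp
    finally show ?thesis by (simp add: mult.assoc)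
  qed
  moreover have "clinear (\<lambda>x. f (g x))"
    by (rule clinearI) (simp_all add: clinear_add clinear_scaleC *)
  ultimately show ?thesis by (auto simp: bounded_clinear_def)
qed

lemma bounded_clinear_id: "bounded_clinear (\<lambda>x. x)"
  unfolding bounded_clinear_def
  by (intro conjI clinearI exI[of _ 1]) auto

lemma bounded_clinear_minus_scaleC:
  assumes "bounded_clinear S"
  shows "bounded_clinear (\<lambda>x. S x - l *\<^sub>C x)"
  using bounded_clinear_add[OF assms bounded_clinear_scaleC[OF bounded_clinear_id], of "- l"]
  by simp

lemma bounded_clinear_op_poly:
  assumes "bounded_clinear S"
  shows "bounded_clinear (op_poly q S)"
proof (induction q)
  case 0
  show ?case by (auto simp: bounded_clinear_def intro!: clinearI exI[of _ 0])
next
  case (pCons a q)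
  have "op_poly (pCons a q) S = (\<lambda>x. a *\<^sub>C x + S (op_poly q S x))"
    using assms by (auto simp: op_poly_pCons bounded_clinear_def)
  then show ?case
    using pCons assms
    by (simp add: bounded_clinear_add bounded_clinear_scaleC bounded_clinear_id bounded_clinear_compose)
qed

text \<open>The polynomial \<open>q(l,w)\<close> in the single variable \<open>w\<close>.\<close>

abbreviation slice :: "complex \<Rightarrow> complex poly poly \<Rightarrow> complex poly" where
  "slice l q \<equiv> map_poly (\<lambda>c. poly c l) q"

lemma eval2_slice: "eval2 q l m = poly (slice l q) m"
  unfolding eval2_def by (induction q) (simp_all add: map_poly_pCons)

lemma degree_slice_le: "degree (slice l q) \<le> degree q"
  by (rule map_poly_degree_leq)

lemma poly_op_eq_sum:
  "degree q \<le> n \<Longrightarrow> poly_op q S T x = (\<Sum>i\<le>n. op_poly (coeff q i) S ((T ^^ i) x))"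
  unfolding poly_op_def op_poly_def[symmetric]
  by (rule sum.mono_neutral_left) (auto simp: coeff_eq_0 not_le)

lemma poly_op_add: "poly_op (p + q) S T x = poly_op p S T x + poly_op q S T x"
  using poly_op_eq_sum[of "p + q" "max (degree p) (degree q)" S T x]
    poly_op_eq_sum[of p "max (degree p) (degree q)" S T x]
    poly_op_eq_sum[of q "max (degree p) (degree q)" S T x]
  by (simp add: degree_add_le op_poly_add sum.distrib)

lemma poly_op_0 [simp]: "poly_op 0 S T x = 0"
  by (simp add: poly_op_def)

lemma poly_op_product:
  assumes "clinear S"
  shows "poly_op (map_poly (\<lambda>c. smult c a) b) S T x = op_poly a S (op_poly b T x)"
  using poly_op_eq_sum[of "map_poly (\<lambda>c. smult c a) b" "degree b" S T x]
  by (simp add: map_poly_degree_leq coeff_map_poly op_poly_smult op_poly_def[of b]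
      clinear_sum[OF clinear_op_poly[OF assms]] clinear_scaleC[OF clinear_op_poly[OF assms]])

lemma poly_op_scale:
  assumes "clinear S"
  shows "poly_op (map_poly (smult c) q) S T x = c *\<^sub>C poly_op q S T x"
  using poly_op_eq_sum[of "map_poly (smult c) q" "degree q" S T x] poly_op_eq_sum[of q "degree q" S T x]
  by (simp add: map_poly_degree_leq coeff_map_poly op_poly_smult complex_vector.scale_sum_right)

lemma cinner_poly_op_eigen:
  assumes "\<And>x. cinner (S x) g = l * cinner x g"
  shows "cinner (poly_op q S T x) g = cinner (op_poly (slice l q) T x) g"
  using poly_op_eq_sum[of q "degree q" S T x] op_poly_eq_sum[OF degree_slice_le, of l q T x]
  by (simp add: cinner_sum_left cinner_scaleC_left coeff_map_poly cinner_op_poly_eigen[OF assms])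

text \<open>The \<open>\<complex>[z,w]\<close>-submodule generated by \<open>f 1, \<dots>, f k\<close>, before taking the closure.\<close>

definition module_span ::
  "('a::complex_inner \<Rightarrow> 'a) \<Rightarrow> ('a \<Rightarrow> 'a) \<Rightarrow> nat \<Rightarrow> (nat \<Rightarrow> 'a) \<Rightarrow> 'a set" where
  "module_span S T k f = {(\<Sum>j=1..k. poly_op (q j) S T (f j)) |q. True}"

lemma generated_subspace_eq: "generated_subspace S T k f = closure (module_span S T k f)"
  by (simp add: generated_subspace_def module_span_def)

lemma subspace_module_span:
  assumes "clinear S"
  shows "csubspace (module_span S T k f)"
proof (rule complex_vector.subspaceI)
  show "0 \<in> module_span S T k f"
    unfolding module_span_def by (intro CollectI exI[of _ "\<lambda>_. 0"]) simp
  show "x + y \<in> module_span S T k f" if xy: "x \<in> module_span S T k f" "y \<in> module_span S T k f" for x y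
  proof -
    obtain q r where "x = (\<Sum>j=1..k. poly_op (q j) S T (f j))" "y = (\<Sum>j=1..k. poly_op (r j) S T (f j))"
      using xy by (auto simp: module_span_def)
    then show ?thesis
      unfolding module_span_def
      by (intro CollectI exI[of _ "\<lambda>j. q j + r j"]) (simp add: poly_op_add sum.distrib)
  qed
  show "c *\<^sub>C x \<in> module_span S T k f" if x: "x \<in> module_span S T k f" for x c
  proof -
    obtain q where "x = (\<Sum>j=1..k. poly_op (q j) S T (f j))"
      using x by (auto simp: module_span_def)
    then show ?thesis
      unfolding module_span_def
      by (intro CollectI exI[of _ "\<lambda>j. map_poly (smult c) (q j)"])
        (simp add: poly_op_scale assms complex_vector.scale_sum_right)
  qed
qed

lemma op_poly_in_module_span:
  assumes "clinear S" "j \<in> {1..k}"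
  shows "op_poly a S (op_poly b T (f j)) \<in> module_span S T k f"
proof -
  define q where "q i = (if i = j then map_poly (\<lambda>c. smult c a) b else 0)" for i
  have "(\<Sum>i=1..k. poly_op (q i) S T (f i)) = (\<Sum>i=1..k. if i = j then op_poly a S (op_poly b T (f j)) else 0)"
    by (rule sum.cong) (simp_all add: q_def poly_op_product assms)
  also have "\<dots> = op_poly a S (op_poly b T (f j))" using assms(2) by simp
  finally show ?thesis
    unfolding module_span_def by (intro CollectI exI[of _ q]) simp
qed

section \<open>Generic slices of a polynomial in two variables\<close>

text \<open>This serves as the nonvanishing of a resultant.  An element \<open>h\<close> of least \<open>w\<close>-degree in the ideal of
  \<open>f\<close> and \<open>g\<close> divides both of them up to factors from \<open>\<complex>[z]\<close>, by pseudo-division.  Since \<open>f\<close> is prime,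
  either \<open>f\<close> divides \<open>h\<close>, and then \<open>g\<close>, or \<open>h\<close> is itself free of \<open>w\<close>.\<close>

lemma irreducible_resultant_exists:
  fixes f g :: "complex poly poly"
  assumes irr: "irreducible f" and deg: "degree f > 0" and ndvd: "\<not> f dvd g"
  obtains A B r where "r \<noteq> 0" "A * f + B * g = [:r:]"
proof -
  define I where "I h \<longleftrightarrow> h \<noteq> 0 \<and> (\<exists>A B. h = A * f + B * g)" for h
  have prime: "prime_elem f" using irr by (rule irreducible_imp_prime_elem)
  have "f \<noteq> 0" using deg by auto
  then have "I f" unfolding I_def by (intro conjI exI[of _ 1] exI[of _ 0]) auto
  then obtain h where h: "I h" and least: "\<And>h'. I h' \<Longrightarrow> degree h \<le> degree h'"
    using ex_has_least_nat[of I f degree] by blast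
  obtain A B where AB: "h = A * f + B * g" and "h \<noteq> 0" using h by (auto simp: I_def)
  have divides: "\<exists>c q. c \<noteq> 0 \<and> [:c:] * x = h * q" if x: "x = C * f + D * g" for x C D
  proof -
    obtain q r where qr: "pseudo_divmod x h = (q, r)" by (metis surj_pair)
    define c where "c = lead_coeff h ^ (Suc (degree x) - degree h)"
    have eq: "[:c:] * x = h * q + r" and small: "r = 0 \<or> degree r < degree h"
      using pseudo_divmod[OF \<open>h \<noteq> 0\<close> qr] by (auto simp: c_def)
    have "r = [:c:] * x - h * q" using eq by simp
    also have "\<dots> = ([:c:] * C - A * q) * f + ([:c:] * D - B * q) * g"
      by (simp only: x AB) algebra
    finally have "r \<noteq> 0 \<Longrightarrow> I r" unfolding I_def by blast
    then have "r = 0" using small least[of r] by force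
    then show ?thesis using eq \<open>h \<noteq> 0\<close> by (intro exI[of _ c] exI[of _ q]) (simp add: c_def)
  qed
  obtain c q where c: "c \<noteq> 0" "[:c:] * f = h * q" using divides[of f 1 0] by auto
  obtain c' q' where c': "c' \<noteq> 0" "[:c':] * g = h * q'" using divides[of g 0 1] by auto
  have not_const: "\<not> f dvd [:d:]" if "d \<noteq> 0" for d
    using dvd_imp_degree_le[of f "[:d:]"] that deg by auto
  have "\<not> f dvd h"
  proof
    assume "f dvd h"
    then have "f dvd [:c':] * g" using c'(2) by simp
    then show False
      using prime_elem_dvd_multD[OF prime] not_const[OF c'(1)] ndvd by blast
  qed
  moreover have "f dvd h * q" using c(2) by (metis dvd_triv_right)
  ultimately have "f dvd q" using prime_elem_dvd_multD[OF prime] by blast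
  then obtain q2 where "q = f * q2" by (elim dvdE)
  then have "f * [:c:] = f * (h * q2)" using c(2) by (simp add: ac_simps)
  then have "[:c:] = h * q2" using \<open>f \<noteq> 0\<close> by (simp only: mult_cancel_left) simp
  moreover have "h * q2 \<noteq> 0" using calculation c(1) by (metis pCons_eq_0_iff)
  ultimately have "degree h = 0"
    by (metis add_is_0 degree_mult_eq degree_pCons_0 mult_zero_left mult_zero_right)
  then obtain r where "h = [:r:]" by (rule degree_eq_zeroE)
  then show ?thesis using that[of r A B] AB \<open>h \<noteq> 0\<close> by auto
qed

lemma finitely_many_common_zeros:
  fixes f g :: "complex poly poly"
  assumes "irreducible f" and "degree f > 0" and "\<not> f dvd g"
  shows "finite {l. \<exists>m. eval2 f l m = 0 \<and> eval2 g l m = 0}"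
proof -
  obtain A B r where r: "r \<noteq> 0" and AB: "A * f + B * g = [:r:]"
    using irreducible_resultant_exists[OF assms] .
  have "poly r l = 0" if "eval2 f l m = 0" "eval2 g l m = 0" for l m
  proof -
    have "eval2 (A * f + B * g) l m = 0"
      using that by (simp add: eval2_def)
    then show ?thesis by (simp add: AB eval2_def)
  qed
  then have "{l. \<exists>m. eval2 f l m = 0 \<and> eval2 g l m = 0} \<subseteq> {l. poly r l = 0}" by blast
  then show ?thesis using poly_roots_finite[OF r] finite_subset by blast
qed

text \<open>If \<open>p = f c\<close>, then \<open>f\<close> divides \<open>p' = f c' + f' c\<close> only if it divides \<open>f'\<close>, which has smaller
  degree, or \<open>c\<close>, which makes \<open>f\<^sup>2\<close> a factor of \<open>p\<close>.\<close>

lemma squarefree_factor_not_dvd_pderiv: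
  fixes f p :: "complex poly poly"
  assumes "squarefree p" "irreducible f" "degree f > 0" "f dvd p"
  shows "\<not> f dvd pderiv p"
proof
  assume dvd: "f dvd pderiv p"
  obtain c where c: "p = f * c" using assms(4) by (elim dvdE)
  have "pderiv p = f * pderiv c + c * pderiv f"
    by (simp add: c pderiv_mult ac_simps)
  then have "f dvd c * pderiv f" using dvd by (metis dvd_add_right_iff dvd_triv_left)
  then consider "f dvd c" | "f dvd pderiv f"
    using prime_elem_dvd_multD[OF irreducible_imp_prime_elem[OF assms(2)]] by blast
  then show False
  proof cases
    case 1
    then have "f ^ 2 dvd p" by (auto simp: c power2_eq_square intro: mult_dvd_mono)
    then show False using squarefreeD[OF assms(1)] assms(2) by (auto simp: irreducible_def)
  next
    case 2
    then show False
      using dvd_imp_degree_le[of f "pderiv f"] assms(3) degree_pderiv[of f] pderiv_eq_0_iff[of f]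
      by auto
  qed
qed

text \<open>A factor in \<open>z\<close> alone vanishes on a whole line \<open>{l} \<times> \<complex>\<close>.  Its points \<open>(l,0)\<close> and \<open>(l,1)\<close> would
  force \<open>l\<close> to lie both in the open disk and on the circle.\<close>

lemma inner_toral_factor_depends_on_w:
  assumes "inner_toral p" "f dvd p" "irreducible f"
  shows "degree f > 0"
proof (rule ccontr)
  assume "\<not> degree f > 0"
  then obtain a where a: "f = [:a:]" using degree_eq_zeroE[of f] by blast
  have "degree a \<noteq> 0"
  proof
    assume "degree a = 0"
    then obtain c where "a = [:c:]" using degree_eq_zeroE[of a] by blast
    with assms(3) a show False
      by (auto simp: irreducible_def is_unit_const_poly_iff dvd_field_iff)
  qed
  then obtain l where l: "poly a l = 0"
    using fundamental_theorem_of_algebra[of a] constant_degree[of a] by auto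
  have "eval2 p l m = 0" for m
    using assms(2) l a by (auto simp: eval2_def elim!: dvdE)
  then have "(l, m) \<in> zero_set p" for m by (simp add: zero_set_def)
  then show False
    using subsetD[OF assms(1)[unfolded inner_toral_def], of "(l, 0)"]
      subsetD[OF assms(1)[unfolded inner_toral_def], of "(l, 1)"] by auto
qed

lemma pderiv_slice: "pderiv (slice l p) = slice l (pderiv p)"
  by (rule poly_eqI) (simp add: coeff_pderiv coeff_map_poly)

lemma slice_generic_root:
  assumes "degree f > 0" "poly (lead_coeff f) l \<noteq> 0"
  obtains m where "eval2 f l m = 0"
proof -
  have "degree (slice l f) = degree f"
    using assms(2) by (intro map_poly_degree_eq) simp
  then have "\<not> constant (poly (slice l f))"
    using assms(1) by (simp add: constant_degree)
  then show ?thesis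
    using fundamental_theorem_of_algebra that by (metis eval2_slice)
qed

text \<open>When \<open>Z\<close> is the set of roots of \<open>r\<close>, all simple, the last property says that \<open>q m\<close> maps any module
  killed by \<open>r\<close> into the eigenspace for \<open>m\<close>; the first writes every vector as a sum of such images.\<close>

lemma Lagrange_basis:
  fixes Z :: "complex set"
  assumes "finite Z" "Z \<noteq> {}"
  obtains q where "(\<Sum>m\<in>Z. q m) = 1"
    "\<And>m m'. m \<in> Z \<Longrightarrow> m' \<in> Z \<Longrightarrow> poly (q m) m' = (if m = m' then 1 else 0)"
    "\<And>m. m \<in> Z \<Longrightarrow> degree (q m) \<le> card Z"
    "\<And>m. m \<in> Z \<Longrightarrow> (\<Prod>z\<in>Z. [:- z, 1:]) dvd [:- m, 1:] * q m"
proof -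
  define q where "q m = smult (1 / (\<Prod>z\<in>Z - {m}. m - z)) (\<Prod>z\<in>Z - {m}. [:- z, 1:])" for m
  have val: "poly (q m) m' = (if m = m' then 1 else 0)" if "m \<in> Z" "m' \<in> Z" for m m'
    using that assms(1) by (auto simp: q_def poly_prod)
  have deg: "degree (q m) < card Z" if "m \<in> Z" for m
  proof -
    have "degree (q m) \<le> degree (\<Prod>z\<in>Z - {m}. [:- z, 1:])"
      by (simp add: q_def)
    also have "\<dots> \<le> (\<Sum>z\<in>Z - {m}. degree [:- z, 1:])"
      using degree_prod_sum_le[of "Z - {m}" "\<lambda>z. [:- z, 1:]"] assms(1) by (simp add: comp_def)
    also have "\<dots> < card Z"
      using that assms(1) card_gt_0_iff[of Z] by auto
    finally show ?thesis .
  qed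
  have "(\<Sum>m\<in>Z. q m) = 1"
  proof (rule poly_eqI_degree[of Z])
    show "poly (\<Sum>m\<in>Z. q m) x = poly 1 x" if "x \<in> Z" for x
      using that assms(1) val[OF _ that] by (simp add: poly_sum sum.delta)
    have "degree (\<Sum>m\<in>Z. q m) \<le> card Z - 1"
    proof (rule degree_sum_le[OF assms(1)])
      show "degree (q m) \<le> card Z - 1" if "m \<in> Z" for m
        using deg[OF that] by linarith
    qed
    moreover have "card Z > 0" using assms by (simp add: card_gt_0_iff)
    ultimately show "degree (\<Sum>m\<in>Z. q m) < card Z" by linarith
    show "degree (1::complex poly) < card Z" using assms by (simp add: card_gt_0_iff)
  qed
  moreover have "(\<Prod>z\<in>Z. [:- z, 1:]) dvd [:- m, 1:] * q m" if "m \<in> Z" for m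
    using that assms(1) by (simp add: q_def prod.remove[of Z m] dvd_smult)
  ultimately show ?thesis using that val deg less_imp_le by blast
qed

section \<open>Pure isometries and their wandering subspaces\<close>

lemma isometry_clinear: "isometry S \<Longrightarrow> clinear S"
  by (simp add: isometry_def)

lemma isometry_bounded_clinear: "isometry S \<Longrightarrow> bounded_clinear S"
  unfolding isometry_def bounded_clinear_def by (auto intro!: exI[of _ 1])

text \<open>Polarisation: the norm determines the real part of the inner product, and the imaginary part follows by
  multiplying one argument by \<open>\<i>\<close>.\<close>

lemma isometry_cinner:
  assumes "isometry S"
  shows "cinner (S x) (S y) = cinner x y"
proof -
  have lin: "clinear S" and n: "\<And>x. norm (S x) = norm x"
    using assms by (auto simp: isometry_def)
  have re: "Re (cinner (S x) (S y)) = Re (cinner x y)" for x y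
    using norm_add_sq[of "S x" "S y"] norm_add_sq[of x y] n[of "x + y"]
    by (simp add: n clinear_add[OF lin])
  have "Im (cinner u v) = Re (cinner u (\<i> *\<^sub>C v))" for u v :: 'a
    by (simp add: cinner_scaleC_right)
  then have "Im (cinner (S x) (S y)) = Im (cinner x y)"
    by (simp add: re flip: clinear_scaleC[OF lin])
  with re show ?thesis by (simp add: complex_eq_iff)
qed

lemma isometry_cadjoint_inverse:
  fixes S :: "'a::chilbert_space \<Rightarrow> 'a"
  assumes "isometry S"
  shows "cadjoint S (S x) = x"
  by (rule cinner_ext)
    (simp add: isometry_cinner assms flip: cinner_cadjoint[OF isometry_bounded_clinear[OF assms]])

lemma cinner_funpow_cadjoint:
  fixes S :: "'a::chilbert_space \<Rightarrow> 'a"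
  assumes "bounded_clinear S"
  shows "cinner y ((cadjoint S ^^ n) z) = cinner ((S ^^ n) y) z"
  by (induction n arbitrary: y)
    (simp_all add: funpow_swap1[of S] flip: cinner_cadjoint[OF assms])

text \<open>\<open>1 - S S\<^sup>*\<close> is the projection onto the orthogonal complement of the range of \<open>S\<close>.\<close>

lemma defect_in_kernel_cadjoint:
  fixes S :: "'a::chilbert_space \<Rightarrow> 'a"
  assumes "isometry S"
  shows "x - S (cadjoint S x) \<in> kernel (cadjoint S)"
  using clinear_diff[OF clinear_cadjoint[OF isometry_bounded_clinear[OF assms]]]
  by (simp add: kernel_def isometry_cadjoint_inverse[OF assms])

text \<open>For \<open>B = ker S\<^sup>*\<close> these are the polynomials in the model of \<open>S\<close> as multiplication by \<open>z\<close>.\<close>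

definition shift_span :: "('a::complex_inner \<Rightarrow> 'a) \<Rightarrow> 'a set \<Rightarrow> 'a set" where
  "shift_span S B = cspan (\<Union>i. (S ^^ i) ` B)"

lemma funpow_in_shift_span: "x \<in> B \<Longrightarrow> (S ^^ i) x \<in> shift_span S B"
  unfolding shift_span_def by (rule complex_vector.span_base) blast

lemma subspace_shift_span: "csubspace (shift_span S B)"
  by (simp add: shift_span_def)

lemma subspace_vimage: "clinear f \<Longrightarrow> csubspace V \<Longrightarrow> csubspace {x. f x \<in> V}"
  by (auto simp: complex_vector.subspace_def clinear_zero clinear_add clinear_scaleC)

lemma clinear_compose: "clinear f \<Longrightarrow> clinear g \<Longrightarrow> clinear (\<lambda>x. f (g x))"
  by (rule clinearI) (simp_all add: clinear_add clinear_scaleC)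

lemma shift_span_minimal:
  assumes "csubspace V" "\<And>i x. x \<in> B \<Longrightarrow> (S ^^ i) x \<in> V"
  shows "shift_span S B \<subseteq> V"
  unfolding shift_span_def using assms by (intro complex_vector.span_minimal) auto

lemma shift_span_shift:
  assumes "clinear S" "x \<in> shift_span S B"
  shows "S x \<in> shift_span S B"
proof -
  have "shift_span S B \<subseteq> {x. S x \<in> shift_span S B}"
    using funpow_in_shift_span[of _ B "Suc _" S]
    by (intro shift_span_minimal subspace_vimage assms subspace_shift_span) auto
  then show ?thesis using assms(2) by blast
qed

lemma shift_span_funpow:
  "clinear S \<Longrightarrow> x \<in> shift_span S B \<Longrightarrow> (S ^^ n) x \<in> shift_span S B"
  by (induction n) (auto intro: shift_span_shift)

lemma shift_span_op_poly:
  "clinear S \<Longrightarrow> x \<in> shift_span S B \<Longrightarrow> op_poly q S x \<in> shift_span S B"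
  unfolding op_poly_def
  by (intro complex_vector.subspace_sum[OF subspace_shift_span]
      complex_vector.subspace_scale[OF subspace_shift_span] shift_span_funpow)

lemma shift_span_span:
  assumes "clinear S" "B \<subseteq> cspan A"
  shows "shift_span S B \<subseteq> shift_span S A"
proof (rule shift_span_minimal)
  fix i x assume "x \<in> B"
  have "cspan A \<subseteq> {x. (S ^^ i) x \<in> shift_span S A}"
    by (intro complex_vector.span_minimal subspace_vimage clinear_funpow assms subspace_shift_span)
      (auto intro: funpow_in_shift_span)
  then show "(S ^^ i) x \<in> shift_span S A" using \<open>x \<in> B\<close> assms(2) by blast
qed (rule subspace_shift_span)

text \<open>The density part of the Wold decomposition: a vector orthogonal to \<open>ker S\<^sup>*\<close> lies in the range of \<open>S\<close>,
  and its preimage is orthogonal to all \<open>S\<^sup>n ker S\<^sup>*\<close> if the vector itself is.  So a vector orthogonal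
  to everything is in the range of each power of \<open>S\<close>, and purity makes it zero.\<close>

lemma wandering_subspace_generates:
  fixes S :: "'a::chilbert_space \<Rightarrow> 'a"
  assumes "pure_isometry S"
  shows "orthocomp (shift_span S (kernel (cadjoint S))) \<subseteq> {0}"
proof
  let ?M = "\<Union>i. (S ^^ i) ` kernel (cadjoint S)"
  have iso: "isometry S" using assms by (simp add: pure_isometry_def)
  have "x \<in> range (S ^^ n)" if "x \<in> orthocomp ?M" for x n
    using that
  proof (induction n arbitrary: x)
    case 0
    show ?case by simp
  next
    case (Suc n)
    define y where "y = cadjoint S x"
    define e where "e = x - S y"
    have e: "e \<in> kernel (cadjoint S)"
      unfolding e_def y_def by (rule defect_in_kernel_cadjoint[OF iso])
    then have "(S ^^ 0) e \<in> ?M" by blast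
    then have "cinner e x = 0" using Suc.prems by (auto simp: orthocomp_def)
    moreover have "cinner e (S y) = 0"
    proof -
      have "cinner (S y) e = 0"
        using e kernel_cadjoint[OF isometry_bounded_clinear[OF iso]] by (auto simp: orthocomp_def)
      then show ?thesis by (subst cinner_commute) simp
    qed
    ultimately have "cinner e e = 0" by (simp add: e_def cinner_diff_right)
    then have x: "x = S y" by (simp add: e_def)
    have "y \<in> orthocomp ?M"
    proof -
      have "cinner ((S ^^ i) b) y = 0" if "b \<in> kernel (cadjoint S)" for i b
      proof -
        have "(S ^^ Suc i) b \<in> ?M" using that by blast
        then have "cinner ((S ^^ Suc i) b) x = 0" using Suc.prems by (auto simp: orthocomp_def)
        then show ?thesis using isometry_cinner[OF iso] by (simp add: x)
      qed
      then show ?thesis by (auto simp: orthocomp_def)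
    qed
    then obtain z where "y = (S ^^ n) z" using Suc.IH by blast
    then show ?case using x by (auto intro!: image_eqI[of _ _ z])
  qed
  then have "x \<in> (\<Inter>j\<in>{1..}. range (S ^^ j))" if "x \<in> orthocomp ?M" for x
    using that by blast
  then show "x \<in> {0}" if "x \<in> orthocomp (shift_span S (kernel (cadjoint S)))" for x
    using that assms unfolding pure_isometry_def shift_span_def orthocomp_span by blast
qed

text \<open>\<open>S\<^sup>n S\<^sup>*\<^sup>n\<close> projects onto the range of \<open>S\<^sup>n\<close>, so the left side is the initial segment of length \<open>n\<close>
  of the power series of \<open>u\<close>.\<close>

lemma truncation_in_shift_span:
  fixes S :: "'a::chilbert_space \<Rightarrow> 'a"
  assumes "isometry S"
  shows "u - (S ^^ n) ((cadjoint S ^^ n) u) \<in> shift_span S (kernel (cadjoint S))"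
proof (induction n)
  case 0
  show ?case using complex_vector.subspace_0[OF subspace_shift_span] by simp
next
  case (Suc n)
  define w where "w = (cadjoint S ^^ n) u"
  have "(S ^^ n) (w - S (cadjoint S w)) \<in> shift_span S (kernel (cadjoint S))"
    by (rule funpow_in_shift_span) (rule defect_in_kernel_cadjoint[OF assms])
  from complex_vector.subspace_add[OF subspace_shift_span Suc.IH this] show ?case
    by (simp add: w_def clinear_diff[OF clinear_funpow[OF isometry_clinear[OF assms]]] funpow_swap1)
qed

section \<open>Rationality of the second isometry\<close>

text \<open>A power series is rational if and only if its backward shifts span a finite dimensional space
  (Kronecker).  For \<open>u = T e\<close> the backward shifts \<open>S\<^sup>*\<^sup>n u\<close> with \<open>n \<ge> 1\<close> all lie in \<open>ker T\<^sup>*\<close>, because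
  \<open>T\<^sup>* S\<^sup>*\<^sup>n T e = S\<^sup>*\<^sup>n e = 0\<close>.  A linear relation between them, with its coefficients reversed, is a
  denominator of \<open>u\<close>.\<close>

lemma denominator_for_wandering_vector:
  fixes S T :: "'a::chilbert_space \<Rightarrow> 'a"
  assumes S: "isometry S" and T: "isometry T" and comm: "\<And>x. S (T x) = T (S x)"
    and F: "finite F" "kernel (cadjoint T) \<subseteq> cspan F" and e: "e \<in> kernel (cadjoint S)"
  obtains Q where "Q \<noteq> 0" "op_poly Q S (T e) \<in> shift_span S (kernel (cadjoint S))"
proof -
  let ?M = "shift_span S (kernel (cadjoint S))"
  note bS = isometry_bounded_clinear[OF S] and bT = isometry_bounded_clinear[OF T]
  define x where "x i = (cadjoint S ^^ Suc i) (T e)" for i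
  have "x i \<in> kernel (cadjoint T)" for i
  proof -
    have "cinner (T y) (x i) = 0" for y
    proof -
      have "cinner (T y) (x i) = cinner ((S ^^ Suc i) (T y)) (T e)"
        unfolding x_def by (rule cinner_funpow_cadjoint[OF bS])
      also have "\<dots> = cinner ((S ^^ Suc i) y) e"
        by (simp only: funpow_commute[of S T, OF comm] isometry_cinner[OF T])
      also have "\<dots> = 0"
        using e by (simp add: kernel_cadjoint[OF bS] orthocomp_def)
      finally show ?thesis .
    qed
    then show ?thesis by (auto simp: kernel_cadjoint[OF bT] orthocomp_def)
  qed
  then have "\<And>i. x i \<in> cspan F" using F(2) by blast
  then obtain q where q: "q \<noteq> 0" "(\<Sum>i\<le>degree q. coeff q i *\<^sub>C x i) = 0"
    using finite_dim_relation[OF F(1), of x] by blast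
  define d where "d = degree q"
  have "op_poly (reflect_poly q) S (T e) = (\<Sum>n\<le>d. coeff q (d - n) *\<^sub>C (S ^^ n) (T e))"
    using op_poly_eq_sum[OF degree_reflect_poly_le, of q S "T e"]
    by (simp add: coeff_reflect_poly d_def)
  also have "\<dots> = (\<Sum>i\<le>d. coeff q i *\<^sub>C (S ^^ (d - i)) (T e))"
    by (rule sum.reindex_bij_witness[of _ "\<lambda>i. d - i" "\<lambda>i. d - i"]) auto
  \<comment> \<open>Each summand is split at degree \<open>i + 1\<close>.  All the tails get the same factor \<open>S\<^sup>d\<^sup>+\<^sup>1\<close>,
    so they add up to an image of the relation between the \<open>x i\<close> and cancel.\<close>
  also have "\<dots> = (\<Sum>i\<le>d. coeff q i *\<^sub>C (S ^^ (d - i)) (T e - (S ^^ Suc i) (x i)))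
      + (S ^^ Suc d) (\<Sum>i\<le>d. coeff q i *\<^sub>C x i)"
  proof -
    have "(S ^^ (d - i)) (T e) = (S ^^ (d - i)) (T e - (S ^^ Suc i) (x i)) + (S ^^ Suc d) (x i)"
      if "i \<le> d" for i
    proof -
      have "(S ^^ Suc d) (x i) = (S ^^ (d - i)) ((S ^^ Suc i) (x i))"
        using that funpow_add[of "d - i" "Suc i" S] by simp
      then show ?thesis
        by (simp add: clinear_diff[OF clinear_funpow[OF isometry_clinear[OF S]]])
    qed
    then have "(\<Sum>i\<le>d. coeff q i *\<^sub>C (S ^^ (d - i)) (T e)) =
        (\<Sum>i\<le>d. coeff q i *\<^sub>C ((S ^^ (d - i)) (T e - (S ^^ Suc i) (x i)) + (S ^^ Suc d) (x i)))"
      by (intro sum.cong) auto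
    then show ?thesis
      by (simp only: scaleC_add_right sum.distrib clinear_sum[OF clinear_funpow[OF isometry_clinear[OF S]]]
          clinear_scaleC[OF clinear_funpow[OF isometry_clinear[OF S]]])
  qed
  also have "(S ^^ Suc d) (\<Sum>i\<le>d. coeff q i *\<^sub>C x i) = 0"
    using q(2) clinear_zero[OF clinear_funpow[OF isometry_clinear[OF S]]] by (simp only: d_def)
  finally have eq: "op_poly (reflect_poly q) S (T e) =
      (\<Sum>i\<le>d. coeff q i *\<^sub>C (S ^^ (d - i)) (T e - (S ^^ Suc i) (x i)))" by simp
  have "op_poly (reflect_poly q) S (T e) \<in> ?M"
    unfolding eq x_def
    by (intro complex_vector.subspace_sum[OF subspace_shift_span]
      complex_vector.subspace_scale[OF subspace_shift_span] shift_span_funpow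
      isometry_clinear[OF S] truncation_in_shift_span[OF S])
  moreover have "reflect_poly q \<noteq> 0" using q(1) by simp
  ultimately show ?thesis using that by blast
qed

text \<open>Multiplying the denominators of the images of a basis of \<open>ker S\<^sup>*\<close> gives \<open>Q\<close> such that \<open>Q(S) T\<close>
  preserves the polynomials; then \<open>Q(S)\<^sup>d\<close> clears the denominators of all \<open>b(T)\<close> of degree up to \<open>d\<close>.\<close>

lemma common_denominator:
  fixes S T :: "'a::chilbert_space \<Rightarrow> 'a"
  assumes S: "isometry S" and T: "isometry T" and comm: "\<And>x. S (T x) = T (S x)"
    and F: "finite F" "kernel (cadjoint T) \<subseteq> cspan F"
    and E: "finite E" "E \<subseteq> kernel (cadjoint S)" "kernel (cadjoint S) \<subseteq> cspan E"
  obtains Q where "Q \<noteq> 0"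
    "\<And>d b x. degree b \<le> d \<Longrightarrow> x \<in> shift_span S (kernel (cadjoint S)) \<Longrightarrow>
       op_poly (Q ^ d) S (op_poly b T x) \<in> shift_span S (kernel (cadjoint S))"
proof -
  let ?E = "kernel (cadjoint S)" and ?M = "shift_span S (kernel (cadjoint S))"
  note lS = isometry_clinear[OF S] and lT = isometry_clinear[OF T]
  have "\<forall>e\<in>E. \<exists>Q. Q \<noteq> 0 \<and> op_poly Q S (T e) \<in> ?M"
    using denominator_for_wandering_vector[OF S T comm F] E(2) by (metis subsetD)
  then obtain R where R: "\<And>e. e \<in> E \<Longrightarrow> R e \<noteq> 0" "\<And>e. e \<in> E \<Longrightarrow> op_poly (R e) S (T e) \<in> ?M"
    by metis
  define Q where "Q = (\<Prod>e\<in>E. R e)"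
  have "op_poly Q S (T e) \<in> ?M" if "e \<in> E" for e
  proof -
    have "Q = (\<Prod>e\<in>E - {e}. R e) * R e"
      using E(1) that by (simp add: Q_def prod.remove mult.commute)
    then show ?thesis
      using R(2)[OF that] by (simp add: op_poly_mult lS shift_span_op_poly)
  qed
  moreover have sub: "csubspace {x. op_poly Q S (T x) \<in> ?M}"
    by (rule subspace_vimage[OF clinear_compose[OF clinear_op_poly[OF lS] lT] subspace_shift_span])
  ultimately have "cspan E \<subseteq> {x. op_poly Q S (T x) \<in> ?M}"
    by (intro complex_vector.span_minimal) auto
  then have onE: "op_poly Q S (T e) \<in> ?M" if "e \<in> ?E" for e using that E(3) by blast
  have "?M \<subseteq> {x. op_poly Q S (T x) \<in> ?M}"
  proof (rule shift_span_minimal[OF sub])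
    fix i x assume x: "x \<in> ?E"
    have "op_poly Q S (T ((S ^^ i) x)) = op_poly Q S ((S ^^ i) (T x))"
      by (simp only: funpow_commute[of S T, OF comm])
    also have "\<dots> = (S ^^ i) (op_poly Q S (T x))"
      by (rule op_poly_commute[of S "S ^^ i", OF funpow_swap1 clinear_funpow[OF lS]])
    finally have "op_poly Q S (T ((S ^^ i) x)) = (S ^^ i) (op_poly Q S (T x))" .
    then show "(S ^^ i) x \<in> {x. op_poly Q S (T x) \<in> ?M}"
      using onE[OF x] by (simp add: shift_span_funpow lS)
  qed
  then have step: "op_poly Q S (T x) \<in> ?M" if "x \<in> ?M" for x using that by blast
  have pow: "op_poly (Q ^ n) S ((T ^^ n) x) \<in> ?M" if "x \<in> ?M" for n x
  proof (induction n)
    case 0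
    show ?case using that by simp
  next
    case (Suc n)
    have "op_poly (Q ^ Suc n) S ((T ^^ Suc n) x) = op_poly Q S (T (op_poly (Q ^ n) S ((T ^^ n) x)))"
      by (simp add: op_poly_mult lS op_poly_commute[of S T, OF comm lT])
    then show ?case using step[OF Suc.IH] by simp
  qed
  have "op_poly (Q ^ d) S (op_poly b T x) \<in> ?M" if d: "degree b \<le> d" and x: "x \<in> ?M" for d b x
  proof -
    have "op_poly (Q ^ d) S ((T ^^ i) x) \<in> ?M" if "i \<le> d" for i
    proof -
      have "Q ^ d = Q ^ (d - i) * Q ^ i" using that by (simp flip: power_add)
      then show ?thesis using pow[OF x, of i] by (simp add: op_poly_mult lS shift_span_op_poly)
    qed
    then show ?thesis
      unfolding op_poly_eq_sum[OF d] clinear_sum[OF clinear_op_poly[OF lS]]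
        clinear_scaleC[OF clinear_op_poly[OF lS]]
      by (intro complex_vector.subspace_sum[OF subspace_shift_span]
          complex_vector.subspace_scale[OF subspace_shift_span]) simp
  qed
  moreover have "Q \<noteq> 0" using R(1) E(1) by (simp add: Q_def)
  ultimately show ?thesis using that by blast
qed

section \<open>Submodules of full rank\<close>

lemma family_independent:
  assumes "\<And>A c. finite A \<Longrightarrow> A \<subseteq> J \<Longrightarrow> (\<Sum>a\<in>A. c a *\<^sub>C f a) = 0 \<Longrightarrow> (\<forall>a\<in>A. c a = 0)"
  shows "inj_on f J" and "cindependent (f ` J)"
proof -
  show inj: "inj_on f J"
  proof (rule inj_onI, rule ccontr)
    fix a b assume ab: "a \<in> J" "b \<in> J" "f a = f b" "a \<noteq> b"
    have "(\<Sum>x\<in>{a, b}. (if x = a then 1 else -1) *\<^sub>C f x) = 0"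
      using ab by simp
    then show False using assms[of "{a, b}" "\<lambda>x. if x = a then 1 else -1"] ab by auto
  qed
  show "cindependent (f ` J)"
    unfolding complex_vector.independent_explicit_finite_subsets
  proof (intro allI impI ballI)
    fix A u v assume A: "A \<subseteq> f ` J" "finite A" "(\<Sum>v\<in>A. u v *\<^sub>C v) = 0" and v: "v \<in> A"
    obtain A' where A': "A' \<subseteq> J" "finite A'" "A = f ` A'"
      using finite_subset_image[OF A(2,1)] by blast
    have "(\<Sum>a\<in>A'. u (f a) *\<^sub>C f a) = 0"
      using A(3) inj_on_subset[OF inj A'(1)] by (simp add: A'(3) sum.reindex)
    then show "u v = 0" using assms[of A' "\<lambda>a. u (f a)"] A' v by auto
  qed
qed

text \<open>A relation between the \<open>g v\<close> over \<open>\<complex>[S]\<close>, paired with the eigenvectors \<open>w v\<close>, shows that every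
  coefficient vanishes at \<open>l\<close>.  Now \<open>S - l\<close> is injective, so the factor \<open>z - l\<close> can be cancelled from the
  whole relation, which lowers the degrees.\<close>

lemma shifts_independent_polys:
  fixes S :: "'a::complex_inner \<Rightarrow> 'a" and g :: "'v \<Rightarrow> 'a"
  assumes S: "isometry S" and l: "cmod l < 1" and I: "finite I"
    and eig: "\<And>v x. v \<in> I \<Longrightarrow> cinner (S x) (w v) = l * cinner x (w v)"
    and dual: "\<And>v v'. v \<in> I \<Longrightarrow> v' \<in> I \<Longrightarrow> cinner (g v) (w v') = 0 \<longleftrightarrow> v \<noteq> v'"
  shows "(\<forall>v\<in>I. q v = 0 \<or> degree (q v) < n) \<Longrightarrow> (\<Sum>v\<in>I. op_poly (q v) S (g v)) = 0 \<Longrightarrow>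
    \<forall>v\<in>I. q v = 0"
proof (induction n arbitrary: q)
  case 0
  then show ?case by auto
next
  case (Suc n)
  note lS = isometry_clinear[OF S]
  have "poly (q v') l = 0" if v': "v' \<in> I" for v'
  proof -
    have "0 = cinner (\<Sum>v\<in>I. op_poly (q v) S (g v)) (w v')" using Suc.prems by simp
    also have "\<dots> = (\<Sum>v\<in>I. poly (q v) l * cinner (g v) (w v'))"
      by (simp add: cinner_sum_left cinner_op_poly_eigen[of S "w v'" l, OF eig[OF v']])
    also have "\<dots> = (\<Sum>v\<in>I. if v = v' then poly (q v) l * cinner (g v) (w v') else 0)"
      using dual v' by (intro sum.cong) auto
    also have "\<dots> = poly (q v') l * cinner (g v') (w v')" using I v' by simp
    finally show ?thesis using dual[OF v' v'] by simp
  qed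
  then have "\<forall>v\<in>I. \<exists>r. q v = [:- l, 1:] * r" unfolding poly_eq_0_iff_dvd dvd_def by blast
  then obtain r where r: "\<And>v. v \<in> I \<Longrightarrow> q v = [:- l, 1:] * r v" by metis
  define y where "y = (\<Sum>v\<in>I. op_poly (r v) S (g v))"
  have "op_poly [:- l, 1:] S y = (\<Sum>v\<in>I. op_poly (q v) S (g v))"
    using r by (simp add: y_def clinear_sum[OF clinear_op_poly[OF lS]] op_poly_mult[OF lS]
        del: mult_pCons_left)
  then have "S y = l *\<^sub>C y"
    using Suc.prems(2) by (simp add: op_poly_pCons lS clinear_zero)
  then have "norm y = cmod l * norm y" using S by (metis isometry_def norm_scaleC)
  then have "y = 0" using l by simp
  moreover have "\<forall>v\<in>I. r v = 0 \<or> degree (r v) < n"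
  proof
    fix v assume v: "v \<in> I"
    show "r v = 0 \<or> degree (r v) < n"
    proof (cases "r v = 0")
      case False
      then have "degree (q v) = Suc (degree (r v))"
        unfolding r[OF v] by (subst degree_mult_eq) auto
      moreover have "q v \<noteq> 0" using False by (simp only: r[OF v] mult_eq_0_iff) simp
      ultimately show ?thesis using Suc.prems(1) v by auto
    qed simp
  qed
  ultimately have r0: "\<forall>v\<in>I. r v = 0" using Suc.IH[of r] unfolding y_def by blast
  show ?case
  proof
    fix v assume "v \<in> I"
    then show "q v = 0" using r0 unfolding r[OF \<open>v \<in> I\<close>] by simp
  qed
qed

lemma op_poly_monom: "op_poly (monom c n) S x = c *\<^sub>C (S ^^ n) x"
proof -
  have "op_poly (monom c n) S x = (\<Sum>i\<le>n. coeff (monom c n) i *\<^sub>C (S ^^ i) x)"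
    by (rule op_poly_eq_sum[OF degree_monom_le])
  also have "\<dots> = (\<Sum>i\<le>n. if i = n then c *\<^sub>C (S ^^ n) x else 0)"
    by (rule sum.cong) auto
  finally have "op_poly (monom c n) S x = (\<Sum>i\<le>n. if i = n then c *\<^sub>C (S ^^ n) x else 0)" .
  then show ?thesis by simp
qed

lemma shifts_independent:
  fixes S :: "'a::complex_inner \<Rightarrow> 'a" and g :: "'v \<Rightarrow> 'a"
  assumes S: "isometry S" and l: "cmod l < 1" and I: "finite I"
    and eig: "\<And>v x. v \<in> I \<Longrightarrow> cinner (S x) (w v) = l * cinner x (w v)"
    and dual: "\<And>v v'. v \<in> I \<Longrightarrow> v' \<in> I \<Longrightarrow> cinner (g v) (w v') = 0 \<longleftrightarrow> v \<noteq> v'"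
  defines "f \<equiv> \<lambda>(i, v). (S ^^ i) (g v)"
  shows "inj_on f (UNIV \<times> I)" and "cindependent (f ` (UNIV \<times> I))"
proof -
  have *: "\<forall>a\<in>A. c a = 0" if A: "finite A" "A \<subseteq> UNIV \<times> I" and 0: "(\<Sum>a\<in>A. c a *\<^sub>C f a) = 0"
    for A :: "(nat \<times> 'v) set" and c
  proof -
    define q where "q v = (\<Sum>a\<in>A. if snd a = v then monom (c a) (fst a) else 0)" for v
    have co: "coeff (q v) i = c (i, v)" if "(i, v) \<in> A" for i v
    proof -
      have "coeff (q v) i = (\<Sum>a\<in>A. if a = (i, v) then c a else 0)"
        unfolding q_def coeff_sum by (rule sum.cong) auto
      then show ?thesis using A(1) that by simp
    qed
    have "(\<Sum>v\<in>I. op_poly (q v) S (g v)) =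
        (\<Sum>v\<in>I. \<Sum>a\<in>A. if snd a = v then c a *\<^sub>C f a else 0)"
      unfolding q_def op_poly_sum
      by (intro sum.cong) (auto simp: op_poly_monom f_def)
    also have "\<dots> = (\<Sum>a\<in>A. \<Sum>v\<in>I. if snd a = v then c a *\<^sub>C f a else 0)"
      by (rule sum.swap)
    also have "\<dots> = (\<Sum>a\<in>A. c a *\<^sub>C f a)"
      using A(2) I by (intro sum.cong) auto
    finally have "(\<Sum>v\<in>I. op_poly (q v) S (g v)) = 0" using 0 by simp
    moreover have "\<forall>v\<in>I. q v = 0 \<or> degree (q v) < Suc (\<Sum>v\<in>I. degree (q v))"
      using I by (auto simp: less_Suc_eq_le intro: member_le_sum)
    ultimately have "\<forall>v\<in>I. q v = 0"
      using shifts_independent_polys[of S l I w g q, OF S l I eig dual] by blast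
    then show ?thesis using co A(2) by fastforce
  qed
  show "inj_on f (UNIV \<times> I)" "cindependent (f ` (UNIV \<times> I))"
    using family_independent[of "UNIV \<times> I" f] * by blast+
qed

text \<open>Counting dimensions: the polynomials of degree less than \<open>n\<close> with coefficients in \<open>E\<close> have dimension at
  most \<open>n card E\<close>.  If all \<open>g v\<close> have degree less than \<open>D\<close>, the polynomials of degree less than
  \<open>D + n\<close> contain the \<open>n card I\<close> independent vectors \<open>S\<^sup>i (g v)\<close> with \<open>i < n\<close>, which leaves at most
  \<open>D card E\<close> further dimensions, independently of \<open>n\<close>.\<close>

lemma shift_span_finite_codim:
  fixes S :: "'a::complex_inner \<Rightarrow> 'a" and g :: "'v \<Rightarrow> 'a"
  assumes S: "clinear S" and E: "finite E" and I: "finite I" and card: "card E \<le> card I"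
    and g: "\<And>v. v \<in> I \<Longrightarrow> g v \<in> shift_span S E"
    and inj: "inj_on (\<lambda>(i, v). (S ^^ i) (g v)) (UNIV \<times> I)"
    and ind: "cindependent ((\<lambda>(i, v). (S ^^ i) (g v)) ` (UNIV \<times> I))"
  obtains C where "finite C" "shift_span S E \<subseteq> cspan ((\<lambda>(i, v). (S ^^ i) (g v)) ` (UNIV \<times> I) \<union> C)"
proof -
  define f where "f = (\<lambda>(i, v). (S ^^ i) (g v))"
  \<comment> \<open>Spans the polynomials of degree less than \<open>n\<close>.\<close>
  define G where "G n = (\<Union>i<n. (S ^^ i) ` E)" for n
  have G_fin: "finite (G n)" for n using E by (simp add: G_def)
  have G_card: "card (G n) \<le> n * card E" for n
  proof -
    have "card (G n) \<le> (\<Sum>i<n. card ((S ^^ i) ` E))"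
      unfolding G_def by (rule card_UN_le) simp
    also have "\<dots> \<le> (\<Sum>i<n. card E)" by (intro sum_mono card_image_le E)
    finally show ?thesis by simp
  qed
  have G_mono: "cspan (G m) \<subseteq> cspan (G n)" if "m \<le> n" for m n
    unfolding G_def using that by (intro complex_vector.span_mono UN_mono) auto
  have G_all: "\<exists>n. x \<in> cspan (G n)" if "x \<in> shift_span S E" for x
  proof -
    have "csubspace {x. \<exists>n. x \<in> cspan (G n)}"
    proof (rule complex_vector.subspaceI)
      show "0 \<in> {x. \<exists>n. x \<in> cspan (G n)}" using complex_vector.span_zero by blast
      show "x + y \<in> {x. \<exists>n. x \<in> cspan (G n)}"
        if xy: "x \<in> {x. \<exists>n. x \<in> cspan (G n)}" "y \<in> {x. \<exists>n. x \<in> cspan (G n)}" for x y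
      proof -
        obtain m n where "x \<in> cspan (G m)" "y \<in> cspan (G n)" using xy by blast
        then have "x + y \<in> cspan (G (max m n))"
          using G_mono[of m "max m n"] G_mono[of n "max m n"] by (intro complex_vector.span_add) auto
        then show ?thesis by blast
      qed
      show "c *\<^sub>C x \<in> {x. \<exists>n. x \<in> cspan (G n)}" if "x \<in> {x. \<exists>n. x \<in> cspan (G n)}" for c x
        using that complex_vector.span_scale by blast
    qed
    moreover have "(S ^^ i) e \<in> cspan (G (Suc i))" if "e \<in> E" for i e
      using that by (intro complex_vector.span_base) (auto simp: G_def)
    ultimately have "shift_span S E \<subseteq> {x. \<exists>n. x \<in> cspan (G n)}"
      by (intro shift_span_minimal) auto
    then show ?thesis using that by blast
  qed
  have G_finite: "\<exists>n. A \<subseteq> cspan (G n)" if "finite A" "A \<subseteq> shift_span S E" for A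
    using that
  proof induction
    case (insert a A)
    then obtain m n where "a \<in> cspan (G m)" "A \<subseteq> cspan (G n)" using G_all by blast
    then have "insert a A \<subseteq> cspan (G (max m n))"
      using G_mono[of m "max m n"] G_mono[of n "max m n"] by auto
    then show ?case by blast
  qed simp
  have G_shift: "(S ^^ i) x \<in> cspan (G (n + i))" if "x \<in> cspan (G n)" for i n x
  proof -
    have "cspan (G n) \<subseteq> {x. (S ^^ i) x \<in> cspan (G (n + i))}"
    proof (intro complex_vector.span_minimal subspace_vimage clinear_funpow S complex_vector.subspace_span subsetI CollectI)
      fix x assume "x \<in> G n"
      then obtain j e where "j < n" "e \<in> E" "x = (S ^^ j) e" by (auto simp: G_def)
      then have "(S ^^ i) x \<in> (S ^^ (i + j)) ` E" "i + j < n + i"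
        by (auto simp: funpow_add)
      then have "(S ^^ i) x \<in> G (n + i)" unfolding G_def by blast
      then show "(S ^^ i) x \<in> cspan (G (n + i))" by (rule complex_vector.span_base)
    qed
    then show ?thesis using that by blast
  qed
  obtain D where D: "g ` I \<subseteq> cspan (G D)" using G_finite[of "g ` I"] I g by blast
  have f_in: "f ` (UNIV \<times> I) \<subseteq> shift_span S E"
    using g S by (auto simp: f_def intro: shift_span_funpow)
  obtain B where B: "f ` (UNIV \<times> I) \<subseteq> B" "B \<subseteq> shift_span S E" "cindependent B" "shift_span S E \<subseteq> cspan B"
    using complex_vector.maximal_independent_subset_extend[OF f_in] ind by (auto simp: f_def)
  define C where "C = B - f ` (UNIV \<times> I)"
  have "finite C"
  proof (rule ccontr)
    assume "infinite C"
    then obtain C' where C': "finite C'" "card C' = D * card E + 1" "C' \<subseteq> C"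
      using infinite_arbitrarily_large by blast
    have "C' \<subseteq> shift_span S E" using C'(3) B(2) by (auto simp: C_def)
    then obtain n where n: "C' \<subseteq> cspan (G n)" using G_finite C'(1) by blast
    define A where "A = f ` ({..<n} \<times> I)"
    have "A \<subseteq> cspan (G (D + n))"
    proof
      fix x assume "x \<in> A"
      then obtain i v where "i < n" "v \<in> I" "x = (S ^^ i) (g v)" by (auto simp: A_def f_def)
      then have "x \<in> cspan (G (D + i))" using D G_shift by blast
      then show "x \<in> cspan (G (D + n))" using G_mono[of "D + i" "D + n"] \<open>i < n\<close> by auto
    qed
    moreover have "C' \<subseteq> cspan (G (D + n))" using n G_mono[of n "D + n"] by auto
    moreover have "cindependent (A \<union> C')"
      by (rule complex_vector.independent_mono[OF B(3)]) (use B(1) C'(3) in \<open>auto simp: A_def C_def\<close>)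
    ultimately have "card (A \<union> C') \<le> card (G (D + n))"
      using complex_vector.independent_span_bound[OF G_fin] by blast
    also have "\<dots> \<le> (D + n) * card E" by (rule G_card)
    finally have le: "card (A \<union> C') \<le> (D + n) * card E" .
    have "card A = n * card I"
      unfolding A_def f_def
      by (subst card_image[OF inj_on_subset[OF inj]]) (auto simp: card_cartesian_product)
    moreover have "finite A" using I by (simp add: A_def)
    moreover have "A \<inter> C' = {}" using C'(3) by (auto simp: A_def C_def)
    ultimately have "card (A \<union> C') = n * card I + D * card E + 1"
      using C'(1,2) by (simp add: card_Un_disjoint)
    moreover have "n * card E \<le> n * card I" using card by (rule mult_le_mono2)
    ultimately show False using le unfolding add_mult_distrib by linarith
  qed
  moreover have "shift_span S E \<subseteq> cspan (f ` (UNIV \<times> I) \<union> C)"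
    using B(1,4) by (simp add: C_def Un_absorb1)
  ultimately show ?thesis using that by (simp add: f_def)
qed

section \<open>Joint eigenspaces of the adjoints\<close>

abbreviation joint_eigenspace ::
  "('a::complex_inner \<Rightarrow> 'a) \<Rightarrow> ('a \<Rightarrow> 'a) \<Rightarrow> complex \<Rightarrow> complex \<Rightarrow> 'a set" where
  "joint_eigenspace S T l m \<equiv>
     kernel (cadjoint (\<lambda>x. S x - l *\<^sub>C x)) \<inter> kernel (cadjoint (\<lambda>x. T x - m *\<^sub>C x))"

lemma kernel_cadjoint_minus_scaleC:
  fixes S :: "'a::chilbert_space \<Rightarrow> 'a"
  assumes "bounded_clinear S"
  shows "kernel (cadjoint (\<lambda>x. S x - l *\<^sub>C x)) = {g. \<forall>x. cinner (S x) g = l * cinner x g}"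
  unfolding kernel_cadjoint[OF bounded_clinear_minus_scaleC[OF assms]]
  by (auto simp: orthocomp_def cinner_diff_left cinner_scaleC_left)

lemma joint_eigenspace_eq:
  fixes S :: "'a::chilbert_space \<Rightarrow> 'a"
  assumes "isometry S" "isometry T"
  shows "joint_eigenspace S T l m =
    {g. (\<forall>x. cinner (S x) g = l * cinner x g) \<and> (\<forall>x. cinner (T x) g = m * cinner x g)}"
  using assms by (auto simp: kernel_cadjoint_minus_scaleC isometry_bounded_clinear)

lemma subspace_eigenspace: "csubspace {g. \<forall>x. cinner (S x) g = l * cinner x g}"
  by (auto simp: complex_vector.subspace_def cinner_add_right cinner_scaleC_right algebra_simps)

lemma subspace_joint_eigenspace:
  fixes S :: "'a::chilbert_space \<Rightarrow> 'a"
  assumes "isometry S" "isometry T"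
  shows "csubspace (joint_eigenspace S T l m)"
  unfolding joint_eigenspace_eq[OF assms] Collect_conj_eq
  by (intro complex_vector.subspace_inter subspace_eigenspace)

lemma joint_eigenvector_orthogonal_to_generated_subspace:
  fixes S :: "'a::chilbert_space \<Rightarrow> 'a"
  assumes "\<And>x. cinner (S x) g = l * cinner x g" "\<And>x. cinner (T x) g = m * cinner x g"
    and "\<And>j. j \<in> {1..k} \<Longrightarrow> cinner (f j) g = 0"
  shows "g \<in> orthocomp (generated_subspace S T k f)"
  unfolding generated_subspace_eq orthocomp_closure
  using assms(3)
  by (auto simp: orthocomp_def module_span_def cinner_sum_left cinner_poly_op_eigen[of S g l, OF assms(1)]
      cinner_op_poly_eigen[of T g m, OF assms(2)])

text \<open>A Lagrange polynomial in \<open>S\<close>, paired with a linear combination of the \<open>g l\<close>, isolates each coefficient.\<close>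

lemma eigenvectors_independent:
  fixes S :: "'a::chilbert_space \<Rightarrow> 'a"
  assumes eig: "\<And>l x. l \<in> \<Lambda> \<Longrightarrow> cinner (S x) (g l) = l * cinner x (g l)"
    and nz: "\<And>l. l \<in> \<Lambda> \<Longrightarrow> g l \<noteq> 0"
  shows "inj_on g \<Lambda>" "cindependent (g ` \<Lambda>)"
proof -
  have *: "\<forall>a\<in>A. c a = 0" if A: "finite A" "A \<subseteq> \<Lambda>" and 0: "(\<Sum>a\<in>A. c a *\<^sub>C g a) = 0" for A c
  proof
    fix a assume a: "a \<in> A"
    then have "A \<noteq> {}" by blast
    then obtain q where q: "\<And>m m'. m \<in> A \<Longrightarrow> m' \<in> A \<Longrightarrow> poly (q m) m' = (if m = m' then 1 else 0)"
      using Lagrange_basis[OF A(1)] by metis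
    have "0 = cinner (op_poly (q a) S (g a)) (\<Sum>b\<in>A. c b *\<^sub>C g b)" using 0 by simp
    also have "\<dots> = (\<Sum>b\<in>A. cnj (c b) * (poly (q a) b * cinner (g a) (g b)))"
      unfolding cinner_sum_right cinner_scaleC_right
      using A(2) by (intro sum.cong refl) (auto simp: cinner_op_poly_eigen[of S "g _", OF eig])
    also have "\<dots> = (\<Sum>b\<in>A. if b = a then cnj (c b) * cinner (g a) (g b) else 0)"
      using q a by (intro sum.cong) auto
    also have "\<dots> = cnj (c a) * cinner (g a) (g a)" using A(1) a by simp
    finally show "c a = 0" using nz a A(2) by auto
  qed
  show "inj_on g \<Lambda>" "cindependent (g ` \<Lambda>)"
    using family_independent[of \<Lambda> g] * by blast+
qed

section \<open>Lower bound\<close>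

text \<open>Each large eigenspace contributes a new dimension to the orthogonal complement of a subspace generated
  by fewer than \<open>k\<close> vectors.\<close>

lemma at_least_nearly_cyclic_if_large_eigenspaces:
  fixes S T :: "'a::chilbert_space \<Rightarrow> 'a"
  assumes S: "isometry S" and T: "isometry T" and inf: "infinite \<Lambda>"
    and dim: "\<And>l. l \<in> \<Lambda> \<Longrightarrow> \<exists>m. cdim (joint_eigenspace S T l m) = enat k"
  shows "at_least_nearly_cyclic S T k"
  unfolding at_least_nearly_cyclic_def
proof (intro allI impI notI)
  fix n f assume n: "n < k" and fin: "finite_codim (generated_subspace S T n f)"
  let ?K = "generated_subspace S T n f"
  have "\<exists>g. g \<noteq> 0 \<and> (\<forall>x. cinner (S x) g = l * cinner x g) \<and> g \<in> orthocomp ?K" if l: "l \<in> \<Lambda>" for l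
  proof -
    obtain m where m: "cdim (joint_eigenspace S T l m) = enat k" using dim[OF l] by blast
    obtain C where C: "C \<subseteq> joint_eigenspace S T l m" "cindependent C" "finite C" "card C = k"
      using cdim_enatE[OF m] by metis
    have "card (f ` {1..n}) < card C"
      using card_image_le[of "{1..n}" f] n C(4) by simp
    then obtain g where g: "g \<in> cspan C" "g \<noteq> 0" "\<And>a. a \<in> f ` {1..n} \<Longrightarrow> cinner a g = 0"
      using nonzero_orthogonal_to_few[OF C(2,3), of "f ` {1..n}"] by blast
    have "g \<in> joint_eigenspace S T l m"
      using g(1) complex_vector.span_minimal[OF C(1) subspace_joint_eigenspace[OF S T]] by blast
    then have e: "\<And>x. cinner (S x) g = l * cinner x g" "\<And>x. cinner (T x) g = m * cinner x g"
      unfolding joint_eigenspace_eq[OF S T] by blast+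
    then have "g \<in> orthocomp ?K"
      by (rule joint_eigenvector_orthogonal_to_generated_subspace) (use g(3) in blast)
    with g(2) e(1) show ?thesis by blast
  qed
  then obtain g where g: "\<And>l. l \<in> \<Lambda> \<Longrightarrow> g l \<noteq> 0" "\<And>l x. l \<in> \<Lambda> \<Longrightarrow> cinner (S x) (g l) = l * cinner x (g l)"
    "\<And>l. l \<in> \<Lambda> \<Longrightarrow> g l \<in> orthocomp ?K" by metis
  have "closed ?K" "csubspace ?K"
    by (simp_all add: generated_subspace_eq subspace_closure subspace_module_span isometry_clinear S)
  then obtain B where B: "finite B" "orthocomp ?K \<subseteq> cspan B"
    using orthocomp_finite_codim fin by metis
  have ind: "inj_on g \<Lambda>" "cindependent (g ` \<Lambda>)"
    using eigenvectors_independent[of \<Lambda> S g] g by blast+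
  have "g ` \<Lambda> \<subseteq> cspan B" using g(3) B(2) by blast
  then have "finite (g ` \<Lambda>)"
    using complex_vector.independent_span_bound[OF B(1) ind(2)] by blast
  then show False using finite_imageD[OF _ ind(1)] inf by blast
qed

text \<open>On \<open>ker (S - l)\<^sup>*\<close> the adjoint of \<open>T\<close> is killed by \<open>p(l,w)\<close> (with conjugated coefficients), which has
  only simple roots, so it is diagonalisable there.\<close>

lemma eigenspace_spanned_by_joint_eigenspaces:
  fixes S T :: "'a::chilbert_space \<Rightarrow> 'a"
  assumes S: "isometry S" and T: "isometry T" and comm: "\<And>x. S (T x) = T (S x)"
    and p0: "\<And>x. poly_op p S T x = 0"
    and r: "rsquarefree (slice l p)" "degree (slice l p) > 0"
  shows "{g. \<forall>x. cinner (S x) g = l * cinner x g} \<subseteq>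
    cspan (\<Union>m\<in>{m. poly (slice l p) m = 0}. joint_eigenspace S T l m)"
proof
  fix v assume "v \<in> {g. \<forall>x. cinner (S x) g = l * cinner x g}"
  then have v: "cinner (S x) v = l * cinner x v" for x by blast
  define Z where "Z = {m. poly (slice l p) m = 0}"
  have r0: "slice l p \<noteq> 0" using r(2) by auto
  have Z: "finite Z" unfolding Z_def by (rule poly_roots_finite[OF r0])
  have "Z \<noteq> {}"
    using fundamental_theorem_of_algebra[of "slice l p"] r(2) constant_degree[of "slice l p"]
    by (auto simp: Z_def)
  then obtain q where q: "(\<Sum>m\<in>Z. q m) = 1"
    "\<And>m. m \<in> Z \<Longrightarrow> (\<Prod>z\<in>Z. [:- z, 1:]) dvd [:- m, 1:] * q m"
    using Lagrange_basis[OF Z] by metis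
  note lT = isometry_clinear[OF T] and bT = isometry_bounded_clinear[OF T]
  \<comment> \<open>The spectral components of \<open>v\<close>.\<close>
  define A where "A m = cadjoint (op_poly (q m) T) v" for m
  have A: "cinner x (A m) = cinner (op_poly (q m) T x) v" for x m
    by (simp add: A_def cinner_cadjoint[OF bounded_clinear_op_poly[OF bT]])
  have kill: "cinner (op_poly (\<Prod>z\<in>Z. [:- z, 1:]) T x) v = 0" for x
  proof -
    have "0 = cinner (poly_op p S T x) v" by (simp add: p0)
    also have "\<dots> = cinner (op_poly (slice l p) T x) v"
      by (rule cinner_poly_op_eigen) (rule v)
    also have "\<dots> = lead_coeff (slice l p) * cinner (op_poly (\<Prod>z\<in>Z. [:- z, 1:]) T x) v"
      using complex_poly_decompose_rsquarefree[OF r(1)]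
      by (metis Z_def cinner_scaleC_left op_poly_smult)
    finally show ?thesis using r0 by simp
  qed
  have "A m \<in> joint_eigenspace S T l m" if m: "m \<in> Z" for m
    unfolding joint_eigenspace_eq[OF S T]
  proof (intro CollectI conjI allI)
    fix x
    have "op_poly (q m) T (S x) = S (op_poly (q m) T x)"
      by (rule op_poly_commute) (simp_all add: comm isometry_clinear S)
    then show "cinner (S x) (A m) = l * cinner x (A m)" by (simp add: A v)
    obtain c where c: "[:- m, 1:] * q m = (\<Prod>z\<in>Z. [:- z, 1:]) * c"
      using q(2)[OF m] by (elim dvdE)
    have "cinner (T x) (A m) - m * cinner x (A m) = cinner (op_poly (q m * [:- m, 1:]) T x) v"
      unfolding op_poly_mult[OF lT]
      by (simp add: A op_poly_pCons lT clinear_zero clinear_add[OF clinear_op_poly[OF lT]]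
          clinear_scaleC[OF clinear_op_poly[OF lT]] cinner_add_left cinner_scaleC_left
          cinner_minus_left clinear_diff[OF clinear_op_poly[OF lT]] cinner_diff_left)
    also have "\<dots> = cinner (op_poly ((\<Prod>z\<in>Z. [:- z, 1:]) * c) T x) v"
      using c by (simp only: mult.commute)
    also have "\<dots> = 0" by (simp add: op_poly_mult lT kill)
    finally show "cinner (T x) (A m) = m * cinner x (A m)" by simp
  qed
  then have "(\<Sum>m\<in>Z. A m) \<in> cspan (\<Union>m\<in>Z. joint_eigenspace S T l m)"
    by (intro complex_vector.span_sum complex_vector.span_base) blast
  moreover have "(\<Sum>m\<in>Z. A m) = v"
  proof (rule cinner_ext)
    show "cinner x (\<Sum>m\<in>Z. A m) = cinner x v" for x
      by (simp add: cinner_sum_right A flip: cinner_sum_left op_poly_sum) (simp add: q(1))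
  qed
  ultimately show "v \<in> cspan (\<Union>m\<in>{m. poly (slice l p) m = 0}. joint_eigenspace S T l m)"
    by (simp add: Z_def)
qed

section \<open>Upper bound\<close>

text \<open>For \<open>\<bar>l\<bar> < 1\<close> the map \<open>1 - cnj l S\<close> carries \<open>ker (S - l)\<^sup>*\<close> onto \<open>ker S\<^sup>*\<close>: a preimage \<open>h\<close> of \<open>e\<close> is
  the fixed point of the contraction \<open>h \<mapsto> e + cnj l S h\<close>.\<close>

lemma card_wandering_le_eigenspace:
  fixes S :: "'a::chilbert_space \<Rightarrow> 'a"
  assumes S: "isometry S" and l: "cmod l < 1"
    and E: "cindependent E" "E \<subseteq> kernel (cadjoint S)"
    and B: "finite B" "{g. \<forall>x. cinner (S x) g = l * cinner x g} \<subseteq> cspan B"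
  shows "card E \<le> card B"
proof -
  define U where "U h = h - cnj l *\<^sub>C S h" for h
  have lin: "Vector_Spaces.linear scaleC scaleC U"
    unfolding clinear_def[symmetric] U_def
    by (rule clinearI)
      (simp_all add: clinear_add clinear_scaleC isometry_clinear S scaleC_add_right scaleC_scaleC
        complex_vector.scale_right_diff_distrib mult.commute)
  have "e \<in> cspan (U ` B)" if e: "e \<in> E" for e
  proof -
    have "\<exists>!h. e + cnj l *\<^sub>C S h = h"
    proof (rule banach_fix_type)
      show "\<forall>x y. dist (e + cnj l *\<^sub>C S x) (e + cnj l *\<^sub>C S y) \<le> cmod l * dist x y"
      proof (intro allI)
        fix x y
        have "(e + cnj l *\<^sub>C S x) - (e + cnj l *\<^sub>C S y) = cnj l *\<^sub>C S (x - y)"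
          by (simp add: clinear_diff[OF isometry_clinear[OF S]] complex_vector.scale_right_diff_distrib)
        then show "dist (e + cnj l *\<^sub>C S x) (e + cnj l *\<^sub>C S y) \<le> cmod l * dist x y"
          using S by (simp add: dist_norm norm_scaleC isometry_def)
      qed
    qed (use l in auto)
    then obtain h where h: "h = e + cnj l *\<^sub>C S h" by metis
    have "cinner (S x) h = l * cinner x h" for x
    proof -
      have "cinner (S x) e = 0"
        using e E(2) kernel_cadjoint[OF isometry_bounded_clinear[OF S]] by (auto simp: orthocomp_def)
      then show ?thesis
        using arg_cong[OF h, of "cinner (S x)"]
        by (simp add: cinner_add_right cinner_scaleC_right isometry_cinner[OF S])
    qed
    then have "h \<in> cspan B" using B(2) by blast
    then have "U h \<in> cspan (U ` B)"
      unfolding complex_vector_pair.linear_span_image[OF lin] by blast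
    moreover have "U h = e" unfolding U_def by (metis h add_diff_cancel_right')
    ultimately show ?thesis by simp
  qed
  then have "card E \<le> card (U ` B)"
    using complex_vector.independent_span_bound[of "U ` B" E] B(1) E(1) by blast
  also have "\<dots> \<le> card B" using B(1) by (rule card_image_le)
  finally show ?thesis .
qed

lemma cdim_independent_bound:
  assumes "cdim M = enat a" "cindependent C" "C \<subseteq> M"
  shows "finite C \<and> card C \<le> a"
  using cdim_enatE[OF assms(1)] complex_vector.independent_span_bound assms(2,3)
  by (metis subset_trans)

text \<open>The eigenvectors in a basis \<open>B\<close> of \<open>ker (S - l)\<^sup>*\<close> are numbered by \<open>\<iota> :: B \<rightarrow> {1..k}\<close>, injectively within
  each eigenspace of \<open>T\<^sup>*\<close>.  The generator \<open>f i\<close> pairs to the same nonzero constant with all eigenvectors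
  numbered \<open>i\<close> and to \<open>0\<close> with the others.  Applying to it the Lagrange polynomial of one eigenvalue in
  \<open>T\<close> then singles out one member of \<open>B\<close>, and this turns the \<open>k\<close> generators into as many vectors as
  \<open>B\<close> has, dual to \<open>B\<close> up to constants.\<close>

lemma at_most_nearly_cyclic_if_small_eigenspaces:
  fixes S T :: "'a::chilbert_space \<Rightarrow> 'a"
  assumes pS: "pure_isometry S" and T: "isometry T" and comm: "\<And>x. S (T x) = T (S x)"
    and E: "finite E" "cindependent E" "E \<subseteq> kernel (cadjoint S)" "kernel (cadjoint S) \<subseteq> cspan E"
    and p0: "\<And>x. poly_op p S T x = 0"
    and l: "cmod l < 1"
    and r: "rsquarefree (slice l p)" "degree (slice l p) > 0"
    and dim: "\<And>m. poly (slice l p) m = 0 \<Longrightarrow> \<exists>a\<le>k. cdim (joint_eigenspace S T l m) = enat a"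
    and Ql: "poly Q l \<noteq> 0"
    and Q: "\<And>d b x. degree b \<le> d \<Longrightarrow> x \<in> shift_span S (kernel (cadjoint S)) \<Longrightarrow>
       op_poly (Q ^ d) S (op_poly b T x) \<in> shift_span S (kernel (cadjoint S))"
    and nz: "(h :: 'a) \<noteq> 0"
  shows "at_most_nearly_cyclic S T k"
proof -
  have S: "isometry S" using pS by (simp add: pure_isometry_def)
  note lS = isometry_clinear[OF S] and lT = isometry_clinear[OF T]
  define L where "L = {g. \<forall>x. cinner (S x) g = l * cinner x g}"
  define Z where "Z = {m. poly (slice l p) m = 0}"
  let ?J = "joint_eigenspace S T l"
  have r0: "slice l p \<noteq> 0" using r(2) by auto
  have Z: "finite Z" unfolding Z_def by (rule poly_roots_finite[OF r0])
  have "Z \<noteq> {}"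
    using fundamental_theorem_of_algebra[of "slice l p"] r(2) constant_degree[of "slice l p"]
    by (auto simp: Z_def)
  then obtain q where
    qval: "\<And>m m'. m \<in> Z \<Longrightarrow> m' \<in> Z \<Longrightarrow> poly (q m) m' = (if m = m' then 1 else 0)" and
    qdeg: "\<And>m. m \<in> Z \<Longrightarrow> degree (q m) \<le> card Z"
    using Lagrange_basis[OF Z] by metis
  obtain B where B: "B \<subseteq> (\<Union>m\<in>Z. ?J m)" "cindependent B" "(\<Union>m\<in>Z. ?J m) \<subseteq> cspan B"
    using complex_vector.maximal_independent_subset by blast
  have LB: "L \<subseteq> cspan B"
    using eigenspace_spanned_by_joint_eigenspaces[OF S T comm p0 r]
      complex_vector.span_minimal[OF B(3) complex_vector.subspace_span]
    by (auto simp: L_def Z_def)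
  have "\<forall>b\<in>B. \<exists>m\<in>Z. b \<in> ?J m" using B(1) by blast
  then obtain \<mu> where \<mu>: "\<And>b. b \<in> B \<Longrightarrow> \<mu> b \<in> Z" "\<And>b. b \<in> B \<Longrightarrow> b \<in> ?J (\<mu> b)" by metis
  have eigS: "cinner (S x) b = l * cinner x b" and eigT: "cinner (T x) b = \<mu> b * cinner x b"
    if "b \<in> B" for b x
    using \<mu>(2)[OF that] unfolding joint_eigenspace_eq[OF S T] by blast+
  have fib: "finite {b\<in>B. \<mu> b = m} \<and> card {b\<in>B. \<mu> b = m} \<le> k" if m: "m \<in> Z" for m
  proof -
    obtain a where a: "a \<le> k" "cdim (?J m) = enat a" using dim[of m] m by (auto simp: Z_def)
    have "cindependent {b\<in>B. \<mu> b = m}" by (rule complex_vector.independent_mono[OF B(2)]) blast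
    then have "finite {b\<in>B. \<mu> b = m} \<and> card {b\<in>B. \<mu> b = m} \<le> a"
      using \<mu>(2) by (intro cdim_independent_bound[OF a(2)]) auto
    then show ?thesis using a(1) by simp
  qed
  have "finite (\<Union>m\<in>Z. {b\<in>B. \<mu> b = m})" using fib Z by blast
  moreover have "(\<Union>m\<in>Z. {b\<in>B. \<mu> b = m}) = B" using \<mu>(1) by blast
  ultimately have Bfin: "finite B" by simp
  have "\<forall>m\<in>Z. \<exists>f. f ` {b\<in>B. \<mu> b = m} \<subseteq> {1..k} \<and> inj_on f {b\<in>B. \<mu> b = m}"
  proof
    fix m assume "m \<in> Z"
    then show "\<exists>f. f ` {b\<in>B. \<mu> b = m} \<subseteq> {1..k} \<and> inj_on f {b\<in>B. \<mu> b = m}"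
      using card_le_inj[of "{b\<in>B. \<mu> b = m}" "{1..k}"] fib by simp
  qed
  then obtain j where j: "\<And>m. m \<in> Z \<Longrightarrow> j m ` {b\<in>B. \<mu> b = m} \<subseteq> {1..k}"
    "\<And>m. m \<in> Z \<Longrightarrow> inj_on (j m) {b\<in>B. \<mu> b = m}" by metis
  define \<iota> where "\<iota> b = j (\<mu> b) b" for b
  have \<iota>: "\<iota> b \<in> {1..k}" if "b \<in> B" for b
    using j(1)[OF \<mu>(1)[OF that]] that unfolding \<iota>_def by blast
  have \<iota>_inj: "b = b'" if "b \<in> B" "b' \<in> B" "\<mu> b = \<mu> b'" "\<iota> b = \<iota> b'" for b b'
    using inj_onD[OF j(2)[OF \<mu>(1)[OF that(1)]], of b b'] that unfolding \<iota>_def by simp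
  have card: "card E \<le> card B"
    by (rule card_wandering_le_eigenspace[OF S l E(2,3) Bfin LB[unfolded L_def]])
  obtain u where u: "\<And>b. b \<in> B \<Longrightarrow> u b \<in> cspan B"
    "\<And>b b'. b \<in> B \<Longrightarrow> b' \<in> B \<Longrightarrow> cinner (u b) b' = (if b = b' then 1 else 0)"
    using dual_basis_exists[OF Bfin B(2)] by blast
  have "csubspace L" unfolding L_def by (rule subspace_eigenspace)
  moreover have "B \<subseteq> L" using eigS by (auto simp: L_def)
  ultimately have uL: "u b \<in> L" if "b \<in> B" for b
    using u(1)[OF that] complex_vector.span_minimal by blast
  define f0 where "f0 i = (\<Sum>b\<in>{b\<in>B. \<iota> b = i}. u b)" for i
  \<comment> \<open>The vectors dual to the eigenvectors lie in \<open>ker (S - l)\<^sup>*\<close>; multiplying by \<open>1 - cnj l S\<close> moves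
    them to \<open>ker S\<^sup>*\<close> and changes the pairings only by the factor \<open>1 - \<bar>l\<bar>\<^sup>2\<close>.\<close>
  define f where "f i = f0 i - cnj l *\<^sub>C S (f0 i)" for i
  have f0L: "f0 i \<in> L" for i
    unfolding f0_def using uL by (intro complex_vector.subspace_sum \<open>csubspace L\<close>) auto
  have f0B: "cinner (f0 i) b = (if \<iota> b = i then 1 else 0)" if b: "b \<in> B" for i b
  proof -
    have "cinner (f0 i) b = (\<Sum>b'\<in>{b\<in>B. \<iota> b = i}. if b' = b then 1 else 0)"
      unfolding f0_def cinner_sum_left using u(2) b by (intro sum.cong) auto
    also have "\<dots> = (if \<iota> b = i then 1 else 0)" using Bfin b by (simp add: sum.delta)
    finally show ?thesis .
  qed
  have fE: "f i \<in> kernel (cadjoint S)" for i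
    unfolding kernel_cadjoint[OF isometry_bounded_clinear[OF S]]
    using f0L[of i]
    by (auto simp: orthocomp_def f_def L_def cinner_diff_right cinner_scaleC_right isometry_cinner[OF S])
  have fB: "cinner (f i) b = (1 - cnj l * l) * cinner (f0 i) b" if "b \<in> B" for i b
    using eigS[OF that] by (simp add: f_def cinner_diff_left cinner_scaleC_left algebra_simps)
  have l1: "1 - cnj l * l \<noteq> 0"
  proof
    assume "1 - cnj l * l = 0"
    then have "l * cnj l = 1" by (simp add: mult.commute)
    then have "(cmod l)\<^sup>2 = 1" by (metis complex_norm_square of_real_eq_1_iff)
    then show False using l abs_square_less_1[of "cmod l"] by simp
  qed
  define d where "d = card Z"
  define g where "g b = op_poly (Q ^ d) S (op_poly (q (\<mu> b)) T (f (\<iota> b)))" for b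
  let ?M = "shift_span S (kernel (cadjoint S))"
  have ME: "?M \<subseteq> shift_span S E" by (rule shift_span_span[OF lS E(4)])
  have gM: "g b \<in> shift_span S E" if "b \<in> B" for b
  proof -
    have "f (\<iota> b) \<in> ?M" using funpow_in_shift_span[of "f (\<iota> b)" _ 0 S, OF fE] by simp
    then have "g b \<in> ?M" unfolding g_def d_def by (intro Q qdeg \<mu>(1) that)
    then show ?thesis using ME by blast
  qed
  have dual: "cinner (g b) b' = 0 \<longleftrightarrow> b \<noteq> b'" if "b \<in> B" "b' \<in> B" for b b'
  proof -
    have "cinner (g b) b' = poly Q l ^ d * (poly (q (\<mu> b)) (\<mu> b') * ((1 - cnj l * l) * cinner (f0 (\<iota> b)) b'))"
      unfolding g_def cinner_op_poly_eigen[of S b' l, OF eigS[OF that(2)]]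
        cinner_op_poly_eigen[of T b' "\<mu> b'", OF eigT[OF that(2)]] fB[OF that(2)]
      by (simp add: poly_power)
    then show ?thesis
      using Ql l1 qval[OF \<mu>(1)[OF that(1)] \<mu>(1)[OF that(2)]] f0B[OF that(2), of "\<iota> b"] \<iota>_inj[OF that]
      by auto
  qed
  let ?F = "(\<lambda>(i, b). (S ^^ i) (g b)) ` (UNIV \<times> B)"
  have ind: "inj_on (\<lambda>(i, b). (S ^^ i) (g b)) (UNIV \<times> B)" "cindependent ?F"
    using shifts_independent[of S l B "\<lambda>b. b" g, OF S l Bfin eigS dual] by blast+
  obtain C where C: "finite C" "shift_span S E \<subseteq> cspan (?F \<union> C)"
    using shift_span_finite_codim[OF lS E(1) Bfin card gM ind] .
  \<comment> \<open>The \<open>f i\<close> need not be distinct, and those whose number is not taken are zero.  Filling the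
    gaps with \<open>h\<close> and giving the vector at \<open>i\<close> the norm \<open>i\<close> makes them distinct without losing any
    of them.\<close>
  define c where "c i = (if f i = 0 then h else f i)" for i
  define f' where "f' i = complex_of_real (real i / norm (c i)) *\<^sub>C c i" for i
  have c0: "c i \<noteq> 0" for i using nz by (simp add: c_def)
  have "norm (f' i) = real i" for i
    using c0[of i] by (simp add: f'_def norm_scaleC norm_divide)
  then have inj: "inj_on f' {1..k}" by (intro inj_onI) (metis of_nat_eq_iff)
  have "\<exists>t. f i = t *\<^sub>C f' i" if "i \<in> {1..k}" for i
  proof (cases "f i = 0")
    case True
    then show ?thesis by (intro exI[of _ 0]) simp
  next
    case False
    then have "f i = complex_of_real (norm (c i) / real i) *\<^sub>C f' i"
      using that by (simp add: f'_def c_def scaleC_scaleC)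
    then show ?thesis by blast
  qed
  then obtain t where t: "\<And>i. i \<in> {1..k} \<Longrightarrow> f i = t i *\<^sub>C f' i" by metis
  let ?K = "generated_subspace S T k f'"
  have "(S ^^ i) (g b) \<in> ?K" if b: "b \<in> B" for i b
  proof -
    have "(S ^^ i) (g b) =
        op_poly (monom 1 i * Q ^ d) S (op_poly (smult (t (\<iota> b)) (q (\<mu> b))) T (f' (\<iota> b)))"
      by (simp add: g_def op_poly_mult lS op_poly_monom t[OF \<iota>[OF b]] op_poly_smult
          clinear_scaleC[OF clinear_op_poly[OF lT]])
    also have "\<dots> \<in> module_span S T k f'" by (rule op_poly_in_module_span[OF lS \<iota>[OF b]])
    finally show ?thesis unfolding generated_subspace_eq using closure_subset by blast
  qed
  then have "?F \<union> C \<subseteq> ?K \<union> C" by auto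
  then have "?M \<subseteq> cspan (?K \<union> C)" using ME C(2) complex_vector.span_mono by blast
  then have "finite_codim ?K"
    by (intro finite_codim_if_dense_in_finite_extension[OF _ _ C(1) _ wandering_subspace_generates[OF pS]])
      (simp_all add: generated_subspace_eq subspace_closure subspace_module_span lS)
  then show ?thesis using inj unfolding at_most_nearly_cyclic_def by blast
qed

lemma eval2_prod: "eval2 (\<Prod>j\<in>A. P j) l m = (\<Prod>j\<in>A. eval2 (P j) l m)"
  by (simp add: eval2_def poly_prod)

text \<open>A double root \<open>m\<close> of \<open>p(l,w)\<close> is a common zero \<open>(l,m)\<close> of some factor \<open>P j\<close> and \<open>\<partial>p/\<partial>w\<close>; there are only
  finitely many such \<open>l\<close>.  Outside the zeros of its leading coefficient, \<open>P j (l,w)\<close> has a root.\<close>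

lemma cofinitely_many_slices_squarefree:
  fixes P :: "nat \<Rightarrow> complex poly poly"
  assumes sq: "squarefree p" and it: "inner_toral p" and p: "p = (\<Prod>j\<in>J. P j)"
    and J: "finite J" and irr: "\<And>j. j \<in> J \<Longrightarrow> irreducible (P j)"
  shows "finite {l. \<not> (rsquarefree (slice l p) \<and> (\<forall>j\<in>J. \<exists>m. eval2 (P j) l m = 0))}"
proof -
  have dvd: "P j dvd p" if "j \<in> J" for j
    unfolding p using J that by (rule dvd_prodI)
  have deg: "degree (P j) > 0" if "j \<in> J" for j
    using inner_toral_factor_depends_on_w[OF it dvd irr] that by blast
  define X where "X j = {l. \<exists>m. eval2 (P j) l m = 0 \<and> eval2 (pderiv p) l m = 0}" for j
  define Y where "Y j = {l. poly (lead_coeff (P j)) l = 0}" for j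
  have "finite (X j)" if "j \<in> J" for j
    unfolding X_def using that
    by (intro finitely_many_common_zeros squarefree_factor_not_dvd_pderiv[OF sq] irr deg dvd)
  moreover have "finite (Y j)" if "j \<in> J" for j
    unfolding Y_def using deg[OF that] by (intro poly_roots_finite) auto
  ultimately have "finite (\<Union>j\<in>J. X j \<union> Y j)" using J by blast
  moreover have "{l. \<not> (rsquarefree (slice l p) \<and> (\<forall>j\<in>J. \<exists>m. eval2 (P j) l m = 0))} \<subseteq> (\<Union>j\<in>J. X j \<union> Y j)"
  proof (rule subsetI, rule ccontr)
    fix l assume bad: "l \<in> {l. \<not> (rsquarefree (slice l p) \<and> (\<forall>j\<in>J. \<exists>m. eval2 (P j) l m = 0))}"
      and l: "l \<notin> (\<Union>j\<in>J. X j \<union> Y j)"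
    have "rsquarefree (slice l p)"
      unfolding rsquarefree_roots pderiv_slice eval2_slice[symmetric]
    proof (intro allI notI)
      fix m assume m: "eval2 p l m = 0 \<and> eval2 (pderiv p) l m = 0"
      then obtain j where "j \<in> J" "eval2 (P j) l m = 0" using J by (auto simp: p eval2_prod)
      then show False using m l by (auto simp: X_def)
    qed
    moreover have "\<exists>m. eval2 (P j) l m = 0" if "j \<in> J" for j
      using slice_generic_root[OF deg[OF that], of l] l that by (auto simp: Y_def)
    ultimately show False using bad by blast
  qed
  ultimately show ?thesis by (rule rev_finite_subset)
qed

section \<open>Near cyclicity of pure isopairs\<close>

theorem theorem1p4:
  fixes S T :: "'a::chilbert_space \<Rightarrow> 'a"
    and p :: "complex poly poly"
    and s :: nat
    and P :: "nat \<Rightarrow> complex poly poly"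
    and \<alpha> :: "nat \<Rightarrow> nat"
  assumes "pure_poly_isopair p S T"
    and "finite_bimultiplicity S T"
    and "minimal_polynomial S T p"
    and "1 \<le> s"
    and "p = (\<Prod>j=1..s. P j)"
    and "\<forall>j\<in>{1..s}. irreducible (P j)"
    and "inj_on P {1..s}"
    and "has_rank S T p s P \<alpha>"
  shows "nearly_cyclic S T (Max (\<alpha> ` {1..s}))"
proof -
  have pS: "pure_isometry S" and pT: "pure_isometry T" and "S \<circ> T = T \<circ> S"
    using assms(1) by (auto simp: pure_poly_isopair_def pure_isopair_def)
  then have S: "isometry S" and T: "isometry T" and comm: "\<And>x. S (T x) = T (S x)"
    by (auto simp: pure_isometry_def fun_eq_iff)
  have sq: "squarefree p" and it: "inner_toral p" and p0: "\<And>x. poly_op p S T x = 0"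
    using assms(3) by (auto simp: minimal_polynomial_def)
  obtain a b where "cdim (kernel (cadjoint S)) = enat a" "cdim (kernel (cadjoint T)) = enat b"
    using assms(2) by (auto simp: finite_bimultiplicity_def bimultiplicity_def isometry_mult_def)
  then obtain E F where
    E: "finite E" "cindependent E" "E \<subseteq> kernel (cadjoint S)" "kernel (cadjoint S) \<subseteq> cspan E" and
    F: "finite F" "kernel (cadjoint T) \<subseteq> cspan F"
    by (metis cdim_enatE)
  obtain Q where Q: "Q \<noteq> 0"
    "\<And>d b x. degree b \<le> d \<Longrightarrow> x \<in> shift_span S (kernel (cadjoint S)) \<Longrightarrow>
       op_poly (Q ^ d) S (op_poly b T x) \<in> shift_span S (kernel (cadjoint S))"
    using common_denominator[OF S T comm F E(1,3,4)] by blast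
  define k where "k = Max (\<alpha> ` {1..s})"
  have "k \<in> \<alpha> ` {1..s}" unfolding k_def using assms(4) by (intro Max_in) auto
  then obtain i where i: "i \<in> {1..s}" "\<alpha> i = k" by blast
  have \<alpha>_le: "\<alpha> j \<le> k" if "j \<in> {1..s}" for j unfolding k_def using that by (intro Max_ge) auto
  have "k > 0" using assms(8) i by (auto simp: has_rank_def)
  \<comment> \<open>The generic points of the disk: every zero of \<open>p\<close> above such a point is regular, each factor
    has one, and the common denominator \<open>Q\<close> does not vanish.\<close>
  define \<Lambda> where "\<Lambda> = {l \<in> ball 0 1. rsquarefree (slice l p) \<and> (\<forall>j\<in>{1..s}. \<exists>m. eval2 (P j) l m = 0)
    \<and> poly Q l \<noteq> 0}"
  have "infinite \<Lambda>"
  proof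
    assume "finite \<Lambda>"
    moreover have "finite {l. \<not> (rsquarefree (slice l p) \<and> (\<forall>j\<in>{1..s}. \<exists>m. eval2 (P j) l m = 0))}"
      using cofinitely_many_slices_squarefree[OF sq it assms(5)] assms(6) by blast
    moreover note poly_roots_finite[OF Q(1)]
    ultimately have "finite (\<Lambda> \<union> {l. \<not> (rsquarefree (slice l p) \<and> (\<forall>j\<in>{1..s}. \<exists>m. eval2 (P j) l m = 0))}
      \<union> {l. poly Q l = 0})" by blast
    moreover have "ball 0 1 \<subseteq> \<Lambda> \<union> {l. \<not> (rsquarefree (slice l p) \<and> (\<forall>j\<in>{1..s}. \<exists>m. eval2 (P j) l m = 0))}
      \<union> {l. poly Q l = 0}" by (auto simp: \<Lambda>_def)
    ultimately have "finite (ball 0 1 :: complex set)" by (rule rev_finite_subset)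
    then show False using uncountable_ball[of 1 "0 :: complex"] countable_finite by auto
  qed
  have rank: "cdim (joint_eigenspace S T l m) = enat (\<alpha> j)"
    if "l \<in> \<Lambda>" "j \<in> {1..s}" "eval2 (P j) l m = 0" for l m j
  proof -
    have l: "cmod l < 1" and rs: "rsquarefree (slice l p)" using that(1) by (auto simp: \<Lambda>_def)
    have "eval2 p l m = 0" using that(2,3) by (auto simp: assms(5) eval2_prod)
    then have "(l, m) \<in> zero_set p" by (simp add: zero_set_def)
    then have "m \<in> ball 0 1" using subsetD[OF it[unfolded inner_toral_def], of "(l, m)"] l by auto
    then have "(l, m) \<in> inner_variety (P j)"
      using l that(3) by (simp add: inner_variety_def zero_set_def)
    moreover have "regular_point p l m"
      using rs \<open>eval2 p l m = 0\<close>
      by (auto simp: regular_point_def pderiv_w_def rsquarefree_roots eval2_slice pderiv_slice)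
    ultimately show ?thesis using assms(8) that(2) unfolding has_rank_def by blast
  qed
  have full: "\<exists>m. cdim (joint_eigenspace S T l m) = enat k" if "l \<in> \<Lambda>" for l
    using rank[OF that i(1)] that i by (force simp: \<Lambda>_def)
  then have least: "at_least_nearly_cyclic S T k"
    by (rule at_least_nearly_cyclic_if_large_eigenspaces[OF S T \<open>infinite \<Lambda>\<close>])
  obtain l where l: "l \<in> \<Lambda>" using \<open>infinite \<Lambda>\<close> by (metis finite.emptyI ex_in_conv)
  obtain h :: 'a where h: "h \<noteq> 0"
  proof -
    obtain m where "cdim (joint_eigenspace S T l m) = enat k" using full[OF l] by blast
    then obtain C :: "'a set" where "cindependent C" "card C = k" by (metis cdim_enatE)
    then have "C \<noteq> {}" "0 \<notin> C" using \<open>k > 0\<close> complex_vector.dependent_zero by auto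
    then obtain c where "c \<in> C" "c \<noteq> 0" by auto
    then show ?thesis using that by blast
  qed
  have rs: "rsquarefree (slice l p)" using l by (simp add: \<Lambda>_def)
  have "degree (slice l p) > 0"
  proof (rule ccontr)
    assume "\<not> degree (slice l p) > 0"
    then obtain c where c: "slice l p = [:c:]" using degree_eq_zeroE[of "slice l p"] by auto
    obtain m where "eval2 (P i) l m = 0" using l i(1) unfolding \<Lambda>_def by blast
    then have "eval2 p l m = 0" using i(1) by (auto simp: assms(5) eval2_prod)
    then have "c = 0" by (simp add: eval2_slice c)
    then show False using rs c by (simp add: rsquarefree_def)
  qed
  moreover have "\<exists>a\<le>k. cdim (joint_eigenspace S T l m) = enat a" if "poly (slice l p) m = 0" for m
  proof -
    have "eval2 p l m = 0" using that by (simp add: eval2_slice)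
    then obtain j where "j \<in> {1..s}" "eval2 (P j) l m = 0" by (auto simp: assms(5) eval2_prod)
    then show ?thesis using rank[OF l] \<alpha>_le by blast
  qed
  moreover have "cmod l < 1" "poly Q l \<noteq> 0" using l by (auto simp: \<Lambda>_def)
  ultimately have "at_most_nearly_cyclic S T k"
    using at_most_nearly_cyclic_if_small_eigenspaces[OF pS T comm E p0 _ rs _ _ _ Q(2) h] by blast
  with least show ?thesis by (simp add: nearly_cyclic_def k_def)
qed

end
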